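(* Let $M\ge1$, let $X\subseteq\mathbb{R}$ be an interval, and let $P$ be a finite positive measure on an interval $S\subseteq\mathbb{R}$ with $\operatorname{card}(\operatorname{supp}P)\ge2M+1$. Let $\psi(x,s)=e^{-(x-s)^2}$ for all $(x,s)\in\mathbb{R}^2$, let $N(x)=\int_S\psi(x,s)\,dP(s)$, and consider the reconstruction framework defined by $P$ and $\overline{\psi}(x,s)=\frac{1}{N(x)}\psi(x,s)$. Then: (1) If $m_0=\sum_{i=1}^Ma_i\delta_{x_i}$, with $x_1<\dots<x_M$ in the interior of $X$ and $a_i>0$ for all $i$, then $m_0$ satisfies the Non-Degenerate Source Condition. (2) If $x_0$ is in the interior of $X$, then the point $x_0$ is $(2M-1)$ Non Degenerate.
   Context: The reconstruction framework defined by $P$ and $\overline\psi$ is: $H=L^2(S,P)$ and $\varphi:X\to H$, $\varphi(x)=\overline{\psi}(x,\cdot)$ (here $\varphi$ denotes the normalized atoms). For $p\in H$, $(\Phi^*p)(x)=\langle\varphi(x),p\rangle_H$. $C_0(X)$ is the space of real-valued continuous functions $\eta$ on $X$ such that for all $\varepsilon>0$ there is a compact $K\subset X$ with $|\eta(x)|\le\varepsilon$ for all $x\in X\setminus K$. For $k\ge0$, $\varphi$ is said to be in $\mathcal{K}^{k}$ if $\varphi\in C^k(X;H)$, the function $x\mapsto\langle p,\varphi(x)\rangle_H$ belongs to $C_0(X)$ for all $p\in H$, and $\sup_{x\in X}\|\varphi^{(i)}(x)\|_H<+\infty$ for all $0\le i\le k$. $\Gamma_x:\mathbb{R}^{2M}\to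 H$ is $\Gamma_xb=\sum_{i=1}^M(b_{2i-1}\varphi(x_i)+b_{2i}\varphi'(x_i))$. If $\Gamma_x$ has full rank (is injective), $p_V$ is the element of minimal norm of $\{p\in H:(\Phi^*p)(x_i)=1,\ (\Phi^*p)'(x_i)=0,\ 1\le i\le M\}$ and $\eta_V=\Phi^*p_V$. The measure $m_0$ satisfies the Non-Degenerate Source Condition if $\Gamma_x$ has full rank, $\eta_V(x)<1$ for all $x\in X\setminus\{x_1,\dots,x_M\}$, and $\eta_V''(x_i)<0$ for all $1\le i\le M$. $F_{2M-1}:\mathbb{R}^{2M}\to H$ is $F_{2M-1}b=\sum_{k=0}^{2M-1}b_{k+1}\varphi^{(k)}(x_0)$. If it has full rank (is injective), $p_W$ is the element of minimal norm of $\{p\in H:(\Phi^*p)(x_0)=1,\ (\Phi^*p)^{(k)}(x_0)=0,\ 1\le k\le2M-1\}$ and $\eta_W=\Phi^*p_W$. The point $x_0$ is $(2M-1)$ Non Degenerate if $\varphi\in\mathcal{K}^{2M}$, $F_{2M-1}$ has full rank, $\eta_W^{(2M)}(x_0)<0$, and $\eta_W(x)<1$ for all $x\in X\setminus\{x_0\}$.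
   Formalization: In (2), full (2M-1) Non Degeneracy is claimed only for compact X: otherwise <1,φ(x)>=1 is not in C_0(X), so φ is not in K^{2M}. For every interval X the C^{2M} regularity of φ, full rank, η_W^{(2M)}(x_0)<0 and η_W<1 off x_0 are still proved. *)

theory Defs
  imports "HOL-Analysis.Analysis"
begin

text \<open>The Hilbert space \<open>H = L\<^sup>2(S,P)\<close> is handled through representatives: its points are the
  square-integrable functions in \<open>L2 P\<close>, and equality in \<open>H\<close> is equality \<open>P\<close>-almost everywhere.
  The interval \<open>S\<close> is the underlying space of \<open>P\<close>.\<close>

definition L2 :: "real measure \<Rightarrow> (real \<Rightarrow> real) set" where
  "L2 P = {f \<in> borel_measurable P. integrable P (\<lambda>s. (f s)\<^sup>2)}"

definition L2_inner :: "real measure \<Rightarrow> (real \<Rightarrow> real) \<Rightarrow> (real \<Rightarrow> real) \<Rightarrow> real" where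
  "L2_inner P f g = (\<integral>s. f s * g s \<partial>P)"

definition L2_norm :: "real measure \<Rightarrow> (real \<Rightarrow> real) \<Rightarrow> real" where
  "L2_norm P f = sqrt (L2_inner P f f)"

text \<open>Differentiability of \<open>\<phi> : X \<rightarrow> H\<close> is with respect to the norm of \<open>H\<close>, one-sided at those end
  points of \<open>X\<close> which belong to \<open>X\<close>. The derivative is unique only up to a null set, and
  \<open>L2_deriv\<close> selects a representative.\<close>

definition L2_has_deriv ::
  "real measure \<Rightarrow> real set \<Rightarrow> (real \<Rightarrow> real \<Rightarrow> real) \<Rightarrow> (real \<Rightarrow> real) \<Rightarrow> real \<Rightarrow> bool" where
  "L2_has_deriv P X \<phi> g x \<longleftrightarrow>
     (\<forall>y\<in>X. \<phi> y \<in> L2 P) \<and> g \<in> L2 P \<and>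
     ((\<lambda>y. L2_norm P (\<lambda>s. (\<phi> y s - \<phi> x s) / (y - x) - g s)) \<longlongrightarrow> 0) (at x within X)"

definition L2_deriv ::
  "real measure \<Rightarrow> real set \<Rightarrow> (real \<Rightarrow> real \<Rightarrow> real) \<Rightarrow> real \<Rightarrow> real \<Rightarrow> real" where
  "L2_deriv P X \<phi> x = (SOME g. L2_has_deriv P X \<phi> g x)"

abbreviation L2_nth_deriv ::
  "real measure \<Rightarrow> real set \<Rightarrow> (real \<Rightarrow> real \<Rightarrow> real) \<Rightarrow> nat \<Rightarrow> real \<Rightarrow> real \<Rightarrow> real" where
  "L2_nth_deriv P X \<phi> k \<equiv> (L2_deriv P X ^^ k) \<phi>"

definition L2_continuous_on ::
  "real measure \<Rightarrow> real set \<Rightarrow> (real \<Rightarrow> real \<Rightarrow> real) \<Rightarrow> bool" where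
  "L2_continuous_on P X \<phi> \<longleftrightarrow>
     (\<forall>x\<in>X. \<phi> x \<in> L2 P) \<and>
     (\<forall>x\<in>X. ((\<lambda>y. L2_norm P (\<lambda>s. \<phi> y s - \<phi> x s)) \<longlongrightarrow> 0) (at x within X))"

definition L2_Ck ::
  "real measure \<Rightarrow> real set \<Rightarrow> nat \<Rightarrow> (real \<Rightarrow> real \<Rightarrow> real) \<Rightarrow> bool" where
  "L2_Ck P X k \<phi> \<longleftrightarrow>
     (\<forall>i<k. \<forall>x\<in>X. \<exists>g. L2_has_deriv P X (L2_nth_deriv P X \<phi> i) g x) \<and>
     L2_continuous_on P X (L2_nth_deriv P X \<phi> k)"

definition C0 :: "real set \<Rightarrow> (real \<Rightarrow> real) set" where
  "C0 X = {\<eta>. continuous_on X \<eta> \<and>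
     (\<forall>\<epsilon>>0. \<exists>K. compact K \<and> K \<subseteq> X \<and> (\<forall>x\<in>X - K. \<bar>\<eta> x\<bar> \<le> \<epsilon>))}"

definition class_K ::
  "real measure \<Rightarrow> real set \<Rightarrow> nat \<Rightarrow> (real \<Rightarrow> real \<Rightarrow> real) \<Rightarrow> bool" where
  "class_K P X k \<phi> \<longleftrightarrow>
     L2_Ck P X k \<phi> \<and>
     (\<forall>p\<in>L2 P. (\<lambda>x. L2_inner P p (\<phi> x)) \<in> C0 X) \<and>
     (\<forall>i\<le>k. bdd_above ((\<lambda>x. L2_norm P (L2_nth_deriv P X \<phi> i x)) ` X))"

definition Phi_adj ::
  "real measure \<Rightarrow> (real \<Rightarrow> real \<Rightarrow> real) \<Rightarrow> (real \<Rightarrow> real) \<Rightarrow> real \<Rightarrow> real" where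
  "Phi_adj P \<phi> p x = L2_inner P (\<phi> x) p"

text \<open>Vectors of \<open>\<real>\<^sup>2\<^sup>M\<close> are functions on \<open>nat\<close> of which only the entries \<open>1, \<dots>, 2M\<close> matter.
  Derivatives of \<open>Phi_adj P \<phi> p\<close> are only ever taken at interior points of \<open>X\<close>, so that the
  unrestricted derivative agrees with the one on \<open>X\<close>. The minimal-norm element is
  unique only up to a null set, which does not affect its image under \<open>Phi_adj P \<phi>\<close>.\<close>

definition full_rank ::
  "real measure \<Rightarrow> nat \<Rightarrow> ((nat \<Rightarrow> real) \<Rightarrow> real \<Rightarrow> real) \<Rightarrow> bool" where
  "full_rank P n L \<longleftrightarrow>
     (\<forall>b c. (AE s in P. L b s = L c s) \<longrightarrow> (\<forall>j\<in>{1..n}. b j = c j))"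

definition Gamma_op ::
  "real measure \<Rightarrow> real set \<Rightarrow> (real \<Rightarrow> real \<Rightarrow> real) \<Rightarrow> nat \<Rightarrow> (nat \<Rightarrow> real) \<Rightarrow>
   (nat \<Rightarrow> real) \<Rightarrow> real \<Rightarrow> real" where
  "Gamma_op P X \<phi> M x b =
     (\<lambda>s. \<Sum>i=1..M. b (2 * i - 1) * \<phi> (x i) s + b (2 * i) * L2_deriv P X \<phi> (x i) s)"

definition p_V ::
  "real measure \<Rightarrow> (real \<Rightarrow> real \<Rightarrow> real) \<Rightarrow> nat \<Rightarrow> (nat \<Rightarrow> real) \<Rightarrow> real \<Rightarrow> real" where
  "p_V P \<phi> M x = arg_min_on (L2_norm P)
     {p \<in> L2 P. \<forall>i\<in>{1..M}. Phi_adj P \<phi> p (x i) = 1 \<and> deriv (Phi_adj P \<phi> p) (x i) = 0}"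

definition eta_V ::
  "real measure \<Rightarrow> (real \<Rightarrow> real \<Rightarrow> real) \<Rightarrow> nat \<Rightarrow> (nat \<Rightarrow> real) \<Rightarrow> real \<Rightarrow> real" where
  "eta_V P \<phi> M x = Phi_adj P \<phi> (p_V P \<phi> M x)"

definition dirac_sum ::
  "real set \<Rightarrow> nat \<Rightarrow> (nat \<Rightarrow> real) \<Rightarrow> (nat \<Rightarrow> real) \<Rightarrow> real measure" where
  "dirac_sum X M a x = measure_of X (sets (restrict_space borel X))
     (\<lambda>A. \<Sum>i=1..M. ennreal (a i) * indicator A (x i))"

lemma emeasure_dirac_sum:
  assumes "A \<in> sets (restrict_space borel X)"
  shows "emeasure (dirac_sum X M a x) A = (\<Sum>i=1..M. ennreal (a i) * indicator A (x i))"
proof -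
  let ?\<mu> = "\<lambda>A. \<Sum>i=1..M. ennreal (a i) * indicator A (x i)"
  have sa: "sigma_algebra X (sets (restrict_space borel X))"
    using sets.sigma_algebra_axioms[of "restrict_space borel X"]
    by (simp add: space_restrict_space)
  have "countably_additive (sets (restrict_space borel X)) ?\<mu>"
  proof (rule countably_additiveI)
    fix B :: "nat \<Rightarrow> real set"
    assume B: "disjoint_family B"
    have "(\<Sum>n. ?\<mu> (B n)) = (\<Sum>i=1..M. \<Sum>n. ennreal (a i) * indicator (B n) (x i))"
      by (rule suminf_sum) (rule summableI)
    also have "\<dots> = (\<Sum>i=1..M. ennreal (a i) * indicator (\<Union>n. B n) (x i))"
      by (simp add: ennreal_suminf_cmult suminf_indicator[OF B])
    finally show "(\<Sum>n. ?\<mu> (B n)) = ?\<mu> (\<Union>n. B n)" .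
  qed
  moreover have "positive (sets (restrict_space borel X)) ?\<mu>"
    by (simp add: positive_def)
  ultimately show ?thesis
    unfolding dirac_sum_def using emeasure_measure_of_sigma[OF sa _ _ assms] by blast
qed

text \<open>The decomposition of \<open>m0\<close> below is unique, since the nodes are strictly increasing and the
  amplitudes positive.\<close>

definition NDSC ::
  "real measure \<Rightarrow> real set \<Rightarrow> (real \<Rightarrow> real \<Rightarrow> real) \<Rightarrow> real measure \<Rightarrow> bool" where
  "NDSC P X \<phi> m0 \<longleftrightarrow>
     (\<exists>M a x. m0 = dirac_sum X M a x \<and> strict_mono_on {1..M} x \<and>
        (\<forall>i\<in>{1..M}. x i \<in> interior X \<and> a i > 0) \<and>
        full_rank P (2 * M) (Gamma_op P X \<phi> M x) \<and>
        (\<forall>y\<in>X - x ` {1..M}. eta_V P \<phi> M x y < 1) \<and>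
        (\<forall>i\<in>{1..M}. (deriv ^^ 2) (eta_V P \<phi> M x) (x i) < 0))"

definition F_op ::
  "real measure \<Rightarrow> real set \<Rightarrow> (real \<Rightarrow> real \<Rightarrow> real) \<Rightarrow> nat \<Rightarrow> real \<Rightarrow>
   (nat \<Rightarrow> real) \<Rightarrow> real \<Rightarrow> real" where
  "F_op P X \<phi> n x0 b = (\<lambda>s. \<Sum>k=0..n. b (k + 1) * L2_nth_deriv P X \<phi> k x0 s)"

definition p_W ::
  "real measure \<Rightarrow> (real \<Rightarrow> real \<Rightarrow> real) \<Rightarrow> nat \<Rightarrow> real \<Rightarrow> real \<Rightarrow> real" where
  "p_W P \<phi> n x0 = arg_min_on (L2_norm P)
     {p \<in> L2 P. Phi_adj P \<phi> p x0 = 1 \<and> (\<forall>k\<in>{1..n}. (deriv ^^ k) (Phi_adj P \<phi> p) x0 = 0)}"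

definition eta_W ::
  "real measure \<Rightarrow> (real \<Rightarrow> real \<Rightarrow> real) \<Rightarrow> nat \<Rightarrow> real \<Rightarrow> real \<Rightarrow> real" where
  "eta_W P \<phi> n x0 = Phi_adj P \<phi> (p_W P \<phi> n x0)"

definition eta_W_nondegenerate ::
  "real measure \<Rightarrow> real set \<Rightarrow> (real \<Rightarrow> real \<Rightarrow> real) \<Rightarrow> nat \<Rightarrow> real \<Rightarrow> bool" where
  "eta_W_nondegenerate P X \<phi> n x0 \<longleftrightarrow>
     full_rank P (n + 1) (F_op P X \<phi> n x0) \<and>
     (deriv ^^ (n + 1)) (eta_W P \<phi> n x0) x0 < 0 \<and>
     (\<forall>x\<in>X - {x0}. eta_W P \<phi> n x0 x < 1)"

text \<open>\<open>nondegenerate_point P X \<phi> n x0\<close> states that \<open>x0\<close> is \<open>n\<close> Non Degenerate; this notion is used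
  for odd \<open>n = 2M - 1\<close>.\<close>

definition nondegenerate_point ::
  "real measure \<Rightarrow> real set \<Rightarrow> (real \<Rightarrow> real \<Rightarrow> real) \<Rightarrow> nat \<Rightarrow> real \<Rightarrow> bool" where
  "nondegenerate_point P X \<phi> n x0 \<longleftrightarrow>
     class_K P X (n + 1) \<phi> \<and> eta_W_nondegenerate P X \<phi> n x0"

definition measure_support :: "real measure \<Rightarrow> real set" where
  "measure_support P = {s \<in> space P. \<forall>U. open U \<and> s \<in> U \<longrightarrow> emeasure P (U \<inter> space P) > 0}"

definition gauss :: "real \<Rightarrow> real \<Rightarrow> real" where
  "gauss x s = exp (- (x - s)\<^sup>2)"

definition gauss_mass :: "real measure \<Rightarrow> real \<Rightarrow> real" where
  "gauss_mass P x = (\<integral>s. gauss x s \<partial>P)"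

definition gauss_atom :: "real measure \<Rightarrow> real \<Rightarrow> real \<Rightarrow> real" where
  "gauss_atom P x s = gauss x s / gauss_mass P x"

text \<open>The constant \<open>1\<close> belongs to \<open>L\<^sup>2(S,P)\<close> and its inner product with every normalized atom
  is \<open>1\<close>. Hence the normalized atoms can be in some class \<open>\<K>\<^sup>k\<close> only when \<open>X\<close> is compact.\<close>

lemma class_K_gauss_atom_imp_compact:
  assumes fin: "finite_measure P" and sP: "sets P = sets (restrict_space borel S)"
    and ne: "emeasure P (space P) > 0" and K: "class_K P X k (gauss_atom P)"
  shows "compact X"
proof -
  interpret finite_measure P by (rule fin)
  have meas: "gauss x \<in> borel_measurable P" for x
  proof -
    have "gauss x \<in> borel_measurable (restrict_space borel S)"
      unfolding gauss_def
      by (intro measurable_restrict_space1 borel_measurable_continuous_onI continuous_intros)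
    then show ?thesis by (simp add: measurable_cong_sets[OF sP refl])
  qed
  have int: "integrable P (gauss x)" for x
    by (rule integrable_const_bound[where B=1]) (auto simp: gauss_def meas)
  have pos: "gauss_mass P x > 0" for x
  proof -
    have "gauss_mass P x \<noteq> 0"
    proof
      assume "gauss_mass P x = 0"
      then have "AE s in P. gauss x s = 0"
        unfolding gauss_mass_def
        by (subst (asm) integral_nonneg_eq_0_iff_AE[OF int]) (auto simp: gauss_def)
      then have "AE s in P. False" by (simp add: gauss_def)
      then show False using ne by (simp add: AE_iff_measurable[OF sets.top])
    qed
    moreover have "gauss_mass P x \<ge> 0" unfolding gauss_mass_def by (simp add: gauss_def)
    ultimately show ?thesis by simp
  qed
  have one: "L2_inner P (\<lambda>s. 1) (gauss_atom P x) = 1" for x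
    using pos[of x] by (simp add: L2_inner_def gauss_atom_def gauss_mass_def)
  have "(\<lambda>s. 1) \<in> L2 P" by (simp add: L2_def)
  then have "(\<lambda>x. L2_inner P (\<lambda>s. 1) (gauss_atom P x)) \<in> C0 X"
    using K by (simp add: class_K_def)
  then have c: "(\<lambda>x::real. 1::real) \<in> C0 X" by (simp add: one)
  have "(1/2::real) > 0" by simp
  with c obtain K where "compact K" "K \<subseteq> X" and "\<forall>x\<in>X - K. \<bar>1::real\<bar> \<le> 1/2"
    unfolding C0_def by blast
  then have "K = X" by auto
  with \<open>compact K\<close> show ?thesis by simp
qed

end

theory Submission
  imports Defs "HOL-Probability.Distributions"
begin

text \<open>
  Write \<open>\<phi>\<close> for the normalized atoms. The constant \<open>1\<close> has inner product \<open>1\<close> with every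
  \<open>\<phi>(x)\<close>, hence \<open>0\<close> with every derivative of \<open>\<phi>\<close>. So the constraints defining \<open>p\<^sub>V\<close> and
  \<open>p\<^sub>W\<close> say that \<open>1 - p\<close> is orthogonal to the representers, and the element of minimal norm is
  the projection of \<open>1\<close> onto their span. As \<open>\<phi>\<close> and its derivatives are quasi-polynomials
  \<open>poly(s) e\<^sup>2\<^sup>x\<^sup>s\<close> times \<open>exp (-s\<^sup>2)\<close>, this gives \<open>1 - p = r(s) exp (-s\<^sup>2)\<close>, where \<open>r\<close> is
  \<open>exp (s\<^sup>2)\<close> minus a quasi-polynomial killed by \<open>L = \<Prod>(D - 2 \<xi>\<^sub>j)\<close>. The operator \<open>L\<close> maps
  \<open>exp (s\<^sup>2)\<close>, a superposition of the functions \<open>e\<^sup>2\<^sup>s\<^sup>t\<close>, to a positive function because the nodes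
  are paired.

  By Rolle, a function with nonvanishing image under \<open>L\<close> has at most \<open>2M\<close> zeros. Being orthogonal
  to the \<open>2M\<close> representers, \<open>r\<close> must change sign \<open>2M\<close> times: otherwise a combination of the
  first few representers would change sign exactly where \<open>r\<close> does. If \<open>L g > 0\<close>, subtract from
  \<open>g\<close> the combination of representers agreeing with it at the zeros of \<open>r\<close>. The difference has
  the same sign as \<open>r\<close> everywhere, so \<open>g\<close> and \<open>r\<close> have positive (weighted) inner product. For \<open>g\<close>
  coming from \<open>\<phi>(y)\<close>, \<open>\<phi>''(x\<^sub>i)\<close> or \<open>\<phi>\<^bsup>(2M)\<^esup>(x\<^sub>0)\<close> this is the claimed strict inequality for the
  certificate.
\<close>

section \<open>Zeros and sign changes\<close>

text \<open>The operators \<open>D - c\<close> are applied to \<open>u\<close> in turn, head of the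
  list first, and the result is \<open>w\<close>. As a relation this also records the
  differentiability of every intermediate function, so regularity need not be tracked
  separately.\<close>

fun diff_op :: "real list \<Rightarrow> (real \<Rightarrow> real) \<Rightarrow> (real \<Rightarrow> real) \<Rightarrow> bool" where
  "diff_op [] u w \<longleftrightarrow> u = w"
| "diff_op (c # cs) u w \<longleftrightarrow>
     (\<exists>v. (\<forall>s. (u has_real_derivative c * u s + v s) (at s)) \<and> diff_op cs v w)"

lemma diff_op_lincomb:
  assumes "diff_op cs u w" "diff_op cs u' w'"
  shows "diff_op cs (\<lambda>s. a * u s + b * u' s) (\<lambda>s. a * w s + b * w' s)"
  using assms
proof (induction cs arbitrary: u u')
  case Nil
  then show ?case by simp
next
  case (Cons c cs)
  then obtain v v' where v: "\<And>s. (u has_real_derivative c * u s + v s) (at s)" "diff_op cs v w"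
    and v': "\<And>s. (u' has_real_derivative c * u' s + v' s) (at s)" "diff_op cs v' w'"
    by auto
  have "((\<lambda>s. a * u s + b * u' s) has_real_derivative
          c * (a * u s + b * u' s) + (a * v s + b * v' s)) (at s)" for s
    by (rule derivative_eq_intros v(1) v'(1) refl)+ (simp add: algebra_simps)
  with Cons.IH[OF v(2) v'(2)] show ?case
    by (auto intro!: exI[of _ "\<lambda>s. a * v s + b * v' s"])
qed

lemma diff_op_zero: "diff_op cs (\<lambda>_. 0) (\<lambda>_. 0)"
  by (induction cs) (auto intro!: exI[of _ "\<lambda>_. 0"])

lemma diff_op_sum:
  assumes "finite J" "\<And>j. j \<in> J \<Longrightarrow> diff_op cs (u j) (w j)"
  shows "diff_op cs (\<lambda>s. \<Sum>j\<in>J. b j * u j s) (\<lambda>s. \<Sum>j\<in>J. b j * w j s)"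
  using assms
proof (induction J rule: finite_induct)
  case empty
  then show ?case by (simp add: diff_op_zero)
next
  case (insert i J)
  then have "diff_op cs (\<lambda>s. b i * u i s + 1 * (\<Sum>j\<in>J. b j * u j s))
     (\<lambda>s. b i * w i s + 1 * (\<Sum>j\<in>J. b j * w j s))"
    by (intro diff_op_lincomb) auto
  with insert show ?case by simp
qed

text \<open>The integrating factor \<open>exp (- c * s)\<close> turns \<open>u\<close> into a
  function with derivative \<open>exp (- c * s) * v s\<close>, so \<open>v\<close> has a zero
  strictly between any two consecutive points of \<open>A\<close>. These zeros avoid
  \<open>A\<close>; zeros of \<open>v\<close> inside \<open>A\<close> therefore count in addition,
  which later excludes double zeros of \<open>u\<close>.\<close>

lemma card_zeros_Rolle:
  fixes u v :: "real \<Rightarrow> real"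
  assumes u: "\<And>s. (u has_real_derivative c * u s + v s) (at s)"
    and fin: "finite {s. v s = 0}" and A: "finite A" "\<And>a. a \<in> A \<Longrightarrow> u a = 0"
  shows "card A + card (A \<inter> {s. v s = 0}) \<le> Suc (card {s. v s = 0})"
proof (cases "A = {}")
  case False
  \<comment> \<open>The successor of \<open>z\<close> within \<open>A\<close>; it is meaningful for
    all points of \<open>A\<close> except the largest.\<close>
  define nxt where "nxt z = Min {a \<in> A. a > z}" for z
  have nxt: "nxt z \<in> A" "z < nxt z" "\<And>a. a \<in> A \<Longrightarrow> z < a \<Longrightarrow> nxt z \<le> a"
    if "z \<in> A - {Max A}" for z
  proof -
    have "Max A \<in> {a \<in> A. a > z}"
      using that A(1) False Max_ge[of A z] by (auto simp: less_le)
    then have "nxt z \<in> {a \<in> A. a > z}"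
      unfolding nxt_def using A(1) by (intro Min_in) auto
    then show "nxt z \<in> A" "z < nxt z" by auto
    show "nxt z \<le> a" if "a \<in> A" "z < a" for a
      unfolding nxt_def using A(1) that by (intro Min_le) auto
  qed
  have "\<exists>t. z < t \<and> t < nxt z \<and> v t = 0" if z: "z \<in> A - {Max A}" for z
  proof -
    define G where "G s = exp (- c * s) * u s" for s
    have G: "(G has_real_derivative exp (- c * s) * v s) (at s)" for s
      unfolding G_def by (rule derivative_eq_intros u refl)+ (simp add: algebra_simps)
    have "\<exists>t>z. t < nxt z \<and> G (nxt z) - G z = (nxt z - z) * (exp (- c * t) * v t)"
      using MVT2[of z "nxt z" G "\<lambda>s. exp (- c * s) * v s"] nxt(2)[OF z] G by blast
    moreover have "G (nxt z) = 0" "G z = 0"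
      using nxt(1)[OF z] z A(2) by (auto simp: G_def)
    ultimately show ?thesis using nxt(2)[OF z] by auto
  qed
  then obtain t where t: "\<And>z. z \<in> A - {Max A} \<Longrightarrow> z < t z"
      "\<And>z. z \<in> A - {Max A} \<Longrightarrow> t z < nxt z" "\<And>z. z \<in> A - {Max A} \<Longrightarrow> v (t z) = 0"
    by metis
  have inj: "inj_on t (A - {Max A})"
  proof (rule linorder_inj_onI')
    fix z z' assume z: "z \<in> A - {Max A}" "z' \<in> A - {Max A}" "z < z'"
    then have "t z < z'" using t(2) nxt(3) by force
    also have "\<dots> < t z'" using t(1) z by auto
    finally show "t z \<noteq> t z'" by simp
  qed
  have notin: "t z \<notin> A" if "z \<in> A - {Max A}" for z
    using t(1,2)[OF that] nxt(3)[OF that] by force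
  have "card (t ` (A - {Max A}) \<union> (A \<inter> {s. v s = 0})) \<le> card {s. v s = 0}"
    using t(3) by (intro card_mono fin) auto
  also have "card (t ` (A - {Max A}) \<union> (A \<inter> {s. v s = 0})) =
      card (t ` (A - {Max A})) + card (A \<inter> {s. v s = 0})"
    using A(1) notin by (intro card_Un_disjoint) auto
  also have "card (t ` (A - {Max A})) = card A - 1"
    using card_image[OF inj] A(1) False by simp
  finally show ?thesis using False A(1) by linarith
qed simp

text \<open>Each first-order factor accounts for at most one zero by Rolle, and after all factors
  the function \<open>w\<close> has none.\<close>

lemma card_zeros_diff_op:
  assumes "diff_op cs u w" "\<And>s. w s \<noteq> 0"
  shows "finite {s. u s = 0} \<and> card {s. u s = 0} \<le> length cs"
  using assms(1)
proof (induction cs arbitrary: u)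
  case Nil
  then show ?case using assms(2) by auto
next
  case (Cons c cs)
  then obtain v where v: "\<And>s. (u has_real_derivative c * u s + v s) (at s)" "diff_op cs v w"
    by auto
  \<comment> \<open>The Rolle count concerns finite sets of zeros; a uniform bound on all of them
    then gives finiteness of the whole zero set.\<close>
  have bd: "card A \<le> Suc (length cs)" if "A \<subseteq> {s. u s = 0}" "finite A" for A
    using card_zeros_Rolle[OF v(1) _ that(2)] Cons.IH[OF v(2)] that by fastforce
  then have fin: "finite {s. u s = 0}"
    by (intro finite_if_finite_subsets_card_bdd[THEN conjunct1]) auto
  with bd show ?case by auto
qed

text \<open>A common zero of \<open>u\<close> and \<open>v\<close> would be counted twice by
  \<open>card_zeros_Rolle\<close> and push the count beyond \<open>length cs\<close>. Hence
  \<open>v a \<noteq> 0\<close>, and \<open>v a\<close> is the derivative of \<open>u\<close> at its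
  zero \<open>a\<close>.\<close>

lemma simple_zeros_diff_op:
  assumes "diff_op cs u w" "\<And>s. w s \<noteq> 0" "card {s. u s = 0} = length cs" "u a = 0"
  shows "\<exists>d. d \<noteq> 0 \<and> (u has_real_derivative d) (at a)"
proof (cases cs)
  case Nil
  then show ?thesis using assms by auto
next
  case (Cons c ds)
  then obtain v where v: "\<And>s. (u has_real_derivative c * u s + v s) (at s)" "diff_op ds v w"
    using assms(1) by auto
  have v0: "finite {s. v s = 0}" "card {s. v s = 0} \<le> length ds"
    using card_zeros_diff_op[OF v(2)] assms(2) by auto
  have fin: "finite {s. u s = 0}" using card_zeros_diff_op[OF assms(1)] assms(2) by auto
  have "card {s. u s = 0} + card ({s. u s = 0} \<inter> {s. v s = 0}) \<le> Suc (card {s. v s = 0})"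
    by (rule card_zeros_Rolle[OF v(1) v0(1) fin]) auto
  then have "card ({s. u s = 0} \<inter> {s. v s = 0}) = 0"
    using v0(2) assms(3) by (simp del: card_eq_0_iff card_0_eq add: Cons)
  then have "v a \<noteq> 0" using fin assms(4) by auto
  then show ?thesis using v(1)[of a] assms(4) by auto
qed

section \<open>Sign changes of continuous functions\<close>

definition changes_sign :: "(real \<Rightarrow> real) \<Rightarrow> real \<Rightarrow> bool" where
  "changes_sign u a \<longleftrightarrow> (\<exists>e>0. \<forall>h. 0 < h \<and> h < e \<longrightarrow> u (a - h) * u (a + h) < 0)"

definition keeps_sign :: "(real \<Rightarrow> real) \<Rightarrow> real \<Rightarrow> bool" where
  "keeps_sign u a \<longleftrightarrow> (\<exists>e>0. \<forall>h. 0 < h \<and> h < e \<longrightarrow> u (a - h) * u (a + h) > 0)"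

lemma changes_sign_simple_zero:
  assumes "(u has_real_derivative d) (at a)" "d \<noteq> 0" "u a = 0"
  shows "changes_sign u a"
proof -
  have main: "\<exists>e>0. \<forall>h. 0 < h \<and> h < e \<longrightarrow> f (a - h) < 0 \<and> f (a + h) > 0"
    if f: "(f has_real_derivative d') (at a)" "d' > 0" "f a = 0" for f d'
  proof -
    obtain e1 where "e1 > 0" "\<forall>h>0. h < e1 \<longrightarrow> f a < f (a + h)"
      using DERIV_pos_inc_right[OF f(1,2)] by auto
    moreover obtain e2 where "e2 > 0" "\<forall>h>0. h < e2 \<longrightarrow> f (a - h) < f a"
      using DERIV_pos_inc_left[OF f(1,2)] by auto
    ultimately show ?thesis using f(3) by (intro exI[of _ "min e1 e2"]) auto
  qed
  show ?thesis
  proof (cases "d > 0")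
    case True
    with main[OF assms(1) True assms(3)] show ?thesis
      unfolding changes_sign_def by (meson mult_neg_pos)
  next
    case False
    then have "- d > 0" using assms(2) by simp
    with main[OF DERIV_minus[OF assms(1)]] assms(3)
    obtain e where "e > 0" "\<forall>h. 0 < h \<and> h < e \<longrightarrow> - u (a - h) < 0 \<and> - u (a + h) > 0"
      by auto
    then show ?thesis
      unfolding changes_sign_def by (intro exI[of _ e]) (auto intro: mult_pos_neg)
  qed
qed

lemma keeps_sign_nonzero:
  assumes "isCont u a" "u a \<noteq> 0"
  shows "keeps_sign u a"
proof -
  obtain e where e: "e > 0" "\<And>y. dist y a < e \<Longrightarrow> dist (u y) (u a) < \<bar>u a\<bar>"
    using assms unfolding continuous_at_eps_delta by (metis zero_less_abs_iff dist_commute)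
  have "u (a - h) * u (a + h) > 0" if "0 < h" "h < e" for h
    using e(2)[of "a - h"] e(2)[of "a + h"] that
    by (cases "u a > 0") (auto simp: dist_real_def abs_if zero_less_mult_iff split: if_splits)
  with e(1) show ?thesis unfolding keeps_sign_def by blast
qed

text \<open>As zeros are isolated, the product \<open>u (a - h) * u (a + h)\<close> does not vanish
  for small \<open>h > 0\<close>, and the intermediate value theorem gives it a constant sign
  there.\<close>

lemma changes_or_keeps_sign:
  assumes "\<And>s. isCont u s" "finite {s. u s = 0}"
  shows "changes_sign u a \<or> keeps_sign u a"
proof -
  obtain e where e: "e > 0" "\<And>s. s \<noteq> a \<Longrightarrow> u s = 0 \<Longrightarrow> e \<le> dist a s"
    using finite_set_avoid[OF assms(2), of a] by auto
  define f where "f h = u (a - h) * u (a + h)" for h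
  have cont: "isCont f h" for h
    unfolding f_def by (intro isCont_mult isCont_o2[OF _ assms(1)] continuous_intros)
  have nz: "f h \<noteq> 0" if "0 < h" "h < e" for h
    using e(2)[of "a - h"] e(2)[of "a + h"] that by (force simp: f_def dist_real_def)
  have sgn: "f h * f (e / 2) > 0" if h: "0 < h" "h < e" for h
  proof (rule ccontr)
    assume neg: "\<not> ?thesis"
    define l r where "l = min h (e/2)" and "r = max h (e/2)"
    have lr: "l \<le> r" "0 < l" "r < e" using h e(1) by (auto simp: l_def r_def)
    have "(f l \<le> 0 \<and> 0 \<le> f r) \<or> (f r \<le> 0 \<and> 0 \<le> f l)"
      using neg by (auto simp: l_def r_def min_def max_def zero_less_mult_iff)
    then have "\<exists>y. l \<le> y \<and> y \<le> r \<and> f y = 0"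
      using IVT[of f l 0 r] IVT2[of f r 0 l] lr(1) cont by blast
    with nz lr show False by force
  qed
  show ?thesis
  proof (cases "f (e/2) > 0")
    case True
    then have "f h > 0" if "0 < h" "h < e" for h using sgn[OF that] by (simp add: zero_less_mult_iff)
    then show ?thesis using e(1) unfolding keeps_sign_def f_def by blast
  next
    case False
    then have "f h < 0" if "0 < h" "h < e" for h using sgn[OF that] by (auto simp: zero_less_mult_iff)
    then show ?thesis using e(1) unfolding changes_sign_def f_def by blast
  qed
qed

text \<open>Both notions compare values at reflected points \<open>a - h\<close> and
  \<open>a + h\<close> through their product, so they behave multiplicatively; the value at
  \<open>a\<close> itself does not enter.\<close>

lemma keeps_sign_mult:
  assumes "(changes_sign u a \<and> changes_sign v a) \<or> (keeps_sign u a \<and> keeps_sign v a)"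
  shows "keeps_sign (\<lambda>s. u s * v s) a"
proof -
  obtain e1 where e1: "e1 > 0"
    "(\<forall>h. 0 < h \<and> h < e1 \<longrightarrow> (u (a - h) * u (a + h)) * (v (a - h) * v (a + h)) > 0)"
    using assms
  proof
    assume "changes_sign u a \<and> changes_sign v a"
    then obtain e e' where "e > 0" "e' > 0" 
      "\<forall>h. 0 < h \<and> h < e \<longrightarrow> u (a - h) * u (a + h) < 0"
      "\<forall>h. 0 < h \<and> h < e' \<longrightarrow> v (a - h) * v (a + h) < 0"
      unfolding changes_sign_def by blast
    then show ?thesis
      by (intro that[of "min e e'"]) (auto intro: mult_neg_neg)
  next
    assume "keeps_sign u a \<and> keeps_sign v a"
    then obtain e e' where "e > 0" "e' > 0" 
      "\<forall>h. 0 < h \<and> h < e \<longrightarrow> u (a - h) * u (a + h) > 0"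
      "\<forall>h. 0 < h \<and> h < e' \<longrightarrow> v (a - h) * v (a + h) > 0"
      unfolding keeps_sign_def by blast
    then show ?thesis
      by (intro that[of "min e e'"]) (auto intro: mult_pos_pos)
  qed
  then show ?thesis unfolding keeps_sign_def by (intro exI[of _ e1]) (auto simp: mult_ac)
qed

text \<open>Let \<open>c\<close> be the supremum of the points of \<open>[a, b]\<close> where
  \<open>u\<close> is positive. To the right of \<open>c\<close> the function is nonpositive, and
  keeping its sign at \<open>c\<close> reflects this to the left, so no positive values accumulate
  at \<open>c\<close>.\<close>

lemma keeps_sign_not_pos_neg:
  assumes cont: "\<And>s. isCont u s" and keep: "\<And>s. keeps_sign u s"
    and ab: "a < b" "u a > 0" "u b < 0"
  shows False
proof -
  define Q where "Q = {s \<in> {a..b}. u s > 0}"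
  define c where "c = Sup Q"
  have Q: "a \<in> Q" "bdd_above Q" using ab by (auto simp: Q_def)
  have c: "a \<le> c" "c \<le> b" unfolding c_def
    using Q by (auto intro!: cSup_upper cSup_least simp: Q_def)
  obtain e where e: "e > 0" "\<And>h. 0 < h \<Longrightarrow> h < e \<Longrightarrow> u (c - h) * u (c + h) > 0"
    using keep unfolding keeps_sign_def by blast
  have right: "u s \<le> 0" if "c < s" "s \<le> b" for s
    using cSup_upper[OF _ Q(2), of s] that c by (force simp: Q_def c_def)
  have uc: "u c \<le> 0"
  proof (rule ccontr)
    assume "\<not> u c \<le> 0"
    then have pos: "u c > 0" by simp
    then have cb: "c < b" using ab(3) c by (cases "c = b") auto
    obtain d where d: "d > 0" "\<And>y. dist y c < d \<Longrightarrow> dist (u y) (u c) < u c"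
      using cont[of c] pos unfolding continuous_at_eps_delta by blast
    define y where "y = c + min (d/2) (b - c)"
    have "c < y" "y \<le> b" "dist y c < d" using d cb by (auto simp: y_def dist_real_def min_def)
    with d(2)[of y] right[of y] show False by (auto simp: dist_real_def)
  qed
  have cb: "u s \<le> 0" if "c - min e (b - c) < s" "s < c" for s
  proof -
    have "u (c - (c - s)) * u (c + (c - s)) > 0" using that by (intro e) auto
    then show ?thesis using right[of "c + (c - s)"] that min.cobounded2[of e "b - c"] by (auto simp: zero_less_mult_iff)
  qed
  \<comment> \<open>For \<open>c < b\<close> the sign is reflected at \<open>c\<close>; for
    \<open>c = b\<close> there may be no room on the right, and continuity at \<open>b\<close> with
    \<open>u b < 0\<close> is used instead.\<close>
  obtain d where d: "d > 0" "\<And>s. c - d < s \<Longrightarrow> s < c \<Longrightarrow> u s \<le> 0"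
  proof (cases "c < b")
    case True
    then show ?thesis using cb e by (intro that[of "min e (b - c)"]) auto
  next
    case False
    then have "u c < 0" using c ab by (cases "c = b") auto
    then obtain d where "d > 0" "\<And>y. dist y c < d \<Longrightarrow> dist (u y) (u c) < - u c"
      using cont[of c] unfolding continuous_at_eps_delta by (metis neg_0_less_iff_less)
    then have "u s < 0" if "c - d < s" "s < c" for s
      using that by (auto simp: dist_real_def abs_less_iff dest!: meta_spec[of _ s])
    then show ?thesis using that \<open>d > 0\<close> less_imp_le by blast
  qed
  have "c - d < Sup Q" using d(1) by (simp add: c_def)
  then obtain q where q: "q \<in> Q" "c - d < q" using less_cSup_iff[of Q "c - d"] Q by auto
  then have "q \<le> c" using cSup_upper[OF _ Q(2)] by (auto simp: c_def)
  then have "u q \<le> 0" using d(2) q uc by (cases "q = c") auto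
  with q show False by (simp add: Q_def)
qed

lemma keeps_sign_constant:
  assumes cont: "\<And>s. isCont u s" and keep: "\<And>s. keeps_sign u s"
  shows "(\<forall>s. u s \<ge> 0) \<or> (\<forall>s. u s \<le> 0)"
proof (rule ccontr)
  assume "\<not> ?thesis"
  then obtain a b where ab: "u a > 0" "u b < 0" by (metis not_le)
  have keep': "keeps_sign (\<lambda>s. - u s) s" for s using keep[of s] by (simp add: keeps_sign_def)
  show False
  proof (cases "a < b")
    case True
    then show False using keeps_sign_not_pos_neg[OF cont keep] ab by blast
  next
    case False
    then have "b < a" using ab by (cases "a = b") auto
    then show False using keeps_sign_not_pos_neg[of "\<lambda>s. - u s" b a] cont keep' ab by auto
  qed
qed

section \<open>Chebyshev systems and orthogonality\<close>

lemma exists_vanishing_lincomb: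
  fixes w :: "'i \<Rightarrow> 'b \<Rightarrow> real"
  assumes "finite A" "finite J" "card A < card J"
  shows "\<exists>b. (\<exists>j\<in>J. b j \<noteq> 0) \<and> (\<forall>a\<in>A. (\<Sum>j\<in>J. b j * w j a) = 0)"
  using assms
proof (induction A arbitrary: J w rule: finite_induct)
  case empty
  then have "J \<noteq> {}" by auto
  then show ?case by (auto intro!: exI[of _ "\<lambda>_. 1"])
next
  case (insert a A)
  show ?case
  proof (cases "\<forall>j\<in>J. w j a = 0")
    case True
    moreover have "card A < card J" using insert by simp
    ultimately show ?thesis using insert.IH[of J w] insert.prems by auto
  next
    case False
    then obtain i where i: "i \<in> J" "w i a \<noteq> 0" by auto
    \<comment> \<open>Gaussian elimination: each \<open>w' j\<close> vanishes at \<open>a\<close>,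
      and the coefficient \<open>b' i\<close> below absorbs the subtracted multiples of
      \<open>w i\<close>.\<close>
    define w' where "w' j s = w j s - w j a / w i a * w i s" for j s
    have "card A < card (J - {i})" using insert i by simp
    then obtain b where b: "\<exists>j\<in>J - {i}. b j \<noteq> 0"
        "\<And>z. z \<in> A \<Longrightarrow> (\<Sum>j\<in>J - {i}. b j * w' j z) = 0"
      using insert.IH[of "J - {i}" w'] insert.prems by auto
    define b' where "b' j = (if j = i then - (\<Sum>l\<in>J - {i}. b l * (w l a / w i a)) else b j)" for j
    have eq: "(\<Sum>j\<in>J. b' j * w j z) = (\<Sum>j\<in>J - {i}. b j * w' j z)" for z
    proof -
      have "(\<Sum>j\<in>J. b' j * w j z) = b' i * w i z + (\<Sum>j\<in>J - {i}. b' j * w j z)"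
        using i insert.prems by (simp add: sum.remove)
      also have "(\<Sum>j\<in>J - {i}. b' j * w j z) = (\<Sum>j\<in>J - {i}. b j * w j z)"
        by (intro sum.cong) (auto simp: b'_def)
      also have "b' i * w i z = - (\<Sum>l\<in>J - {i}. b l * (w l a / w i a) * w i z)"
        by (simp add: b'_def sum_distrib_right)
      finally show ?thesis
        by (simp add: w'_def algebra_simps sum_subtractf)
    qed
    have "(\<Sum>j\<in>J - {i}. b j * w' j a) = 0"
      using i by (intro sum.neutral) (auto simp: w'_def)
    moreover have "\<exists>j\<in>J. b' j \<noteq> 0" using b(1) by (auto simp: b'_def)
    ultimately show ?thesis using b(2) eq by (intro exI[of _ b']) auto
  qed
qed


text \<open>This makes \<open>w 0, \<dots>, w n\<close> an extended complete Chebyshev system.\<close>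

definition chebyshev :: "real list \<Rightarrow> nat \<Rightarrow> (nat \<Rightarrow> real \<Rightarrow> real) \<Rightarrow> bool" where
  "chebyshev cs n w \<longleftrightarrow>
     (\<forall>j\<le>n. \<exists>\<omega>. (\<forall>s. \<omega> s > 0) \<and> diff_op (take j cs) (w j) \<omega>) \<and>
     (\<forall>i\<le>n. \<forall>j<i. diff_op (take i cs) (w j) (\<lambda>_. 0))"

text \<open>The first \<open>k\<close> factors annihilate every \<open>w j\<close> with
  \<open>j < k\<close>, so only the top term survives.\<close>

lemma chebyshev_lincomb:
  assumes ch: "chebyshev cs n w" and k: "k \<le> n" and b: "b k \<noteq> 0"
  shows "\<exists>\<omega>. (\<forall>s. \<omega> s > 0) \<and> diff_op (take k cs) (w k) \<omega> \<and>
     diff_op (take k cs) (\<lambda>s. \<Sum>j\<le>k. b j * w j s) (\<lambda>s. b k * \<omega> s)"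
proof -
  obtain \<omega> where \<omega>: "\<And>s. \<omega> s > 0" "diff_op (take k cs) (w k) \<omega>"
    using ch k unfolding chebyshev_def by blast
  have "diff_op (take k cs) (\<lambda>s. \<Sum>j\<le>k. b j * w j s) (\<lambda>s. \<Sum>j\<le>k. b j * (if j = k then \<omega> s else 0))"
  proof (rule diff_op_sum)
    fix j assume "j \<in> {..k}"
    then show "diff_op (take k cs) (w j) (\<lambda>s. if j = k then \<omega> s else 0)"
      using \<omega>(2) ch k by (cases "j = k") (auto simp: chebyshev_def)
  qed simp
  also have "(\<lambda>s. \<Sum>j\<le>k. b j * (if j = k then \<omega> s else 0)) = (\<lambda>s. b k * \<omega> s)"
    by (intro ext) (simp add: if_distrib[of "(*) _"] cong: if_cong)
  finally show ?thesis using \<omega> by blast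
qed

text \<open>If \<open>m\<close> is the last index with a nonzero coefficient, the first
  \<open>m\<close> factors map the combination to a function without zeros, so it has at most
  \<open>m\<close> zeros. Attaining \<open>k\<close> zeros therefore forces
  \<open>m = k\<close>.\<close>

lemma chebyshev_zeros:
  assumes ch: "chebyshev cs n w" and k: "k \<le> n" and b: "\<exists>j\<le>k. b j \<noteq> 0"
  defines "T \<equiv> \<lambda>s. \<Sum>j\<le>k. b j * w j s"
  shows "finite {s. T s = 0}" "card {s. T s = 0} \<le> k"
    "card {s. T s = 0} = k \<Longrightarrow> length cs = n \<Longrightarrow> b k \<noteq> 0"
proof -
  define m where "m = Max {j. j \<le> k \<and> b j \<noteq> 0}"
  have "m \<in> {j. j \<le> k \<and> b j \<noteq> 0}"
    unfolding m_def using b by (intro Max_in) auto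
  then have m: "m \<le> k" "b m \<noteq> 0" by auto
  have above: "b j = 0" if "m < j" "j \<le> k" for j
  proof (rule ccontr)
    assume "b j \<noteq> 0"
    then have "j \<le> m" unfolding m_def using that by (intro Max_ge) auto
    with that show False by simp
  qed
  have T: "T = (\<lambda>s. \<Sum>j\<le>m. b j * w j s)"
    unfolding T_def using m(1) above by (intro ext sum.mono_neutral_right) auto
  obtain \<omega> where "\<And>s. \<omega> s > 0" "diff_op (take m cs) T (\<lambda>s. b m * \<omega> s)"
    using chebyshev_lincomb[OF ch, of m b] m k T by force
  then have *: "finite {s. T s = 0} \<and> card {s. T s = 0} \<le> length (take m cs)"
    by (intro card_zeros_diff_op) (auto simp: m less_imp_neq[symmetric])
  have len: "length (take m cs) \<le> m" by simp
  show "finite {s. T s = 0}" "card {s. T s = 0} \<le> k" using * m by auto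
  show "b k \<noteq> 0" if "card {s. T s = 0} = k" "length cs = n"
  proof -
    have "k \<le> m" using * len that by linarith
    with m show ?thesis by auto
  qed
qed

text \<open>If the signs at \<open>s\<close> were opposite, the combination of \<open>u\<close> and
  \<open>u'\<close> with the positive weights \<open>\<bar>u' s\<bar>\<close> and
  \<open>\<bar>u s\<bar>\<close> would vanish at \<open>s\<close> as well as on \<open>A\<close>.
  That is one zero too many for a function with positive image under the operator.\<close>

lemma same_zeros_same_sign:
  assumes "diff_op cs u w" "diff_op cs u' w'" "\<And>s. w s > 0" "\<And>s. w' s > 0"
    and "finite A" "card A = length cs" "\<And>a. a \<in> A \<Longrightarrow> u a = 0 \<and> u' a = 0"
  shows "u s * u' s \<ge> 0"
proof (rule ccontr)
  assume neg: "\<not> ?thesis"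
  define \<alpha> \<beta> where "\<alpha> = \<bar>u' s\<bar>" and "\<beta> = \<bar>u s\<bar>"
  define T where "T z = \<alpha> * u z + \<beta> * u' z" for z
  have ab: "\<alpha> > 0" "\<beta> > 0" using neg by (auto simp: \<alpha>_def \<beta>_def)
  have "T s = 0" using neg by (auto simp: T_def \<alpha>_def \<beta>_def abs_if mult_nonneg_nonneg
        mult_nonpos_nonpos split: if_splits)
  then have "insert s A \<subseteq> {z. T z = 0}" using assms(7) by (auto simp: T_def)
  moreover have "finite {z. T z = 0} \<and> card {z. T z = 0} \<le> length cs"
    unfolding T_def
    by (intro card_zeros_diff_op[OF diff_op_lincomb[OF assms(1,2)]])
      (use assms ab in \<open>auto intro!: less_imp_neq[symmetric] add_pos_pos\<close>)
  ultimately have "card (insert s A) \<le> length cs" using card_mono le_trans by blast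
  moreover have "s \<notin> A" using assms(7) neg by force
  ultimately show False using assms(5,6) by simp
qed

text \<open>With \<open>k\<close> sign changes of \<open>r\<close>, a combination \<open>T\<close>
  of \<open>w 0, \<dots>, w k\<close> vanishes exactly there. If \<open>k < n\<close>, then
  \<open>T * r\<close> has one sign and zero integral, which is impossible. So \<open>k = n\<close>,
  and \<open>T\<close>, scaled to leading coefficient 1, has the sign of \<open>r\<close>; by
  orthogonality its integral against \<open>r\<close> is that of \<open>w n\<close>.\<close>

lemma orthogonal_remainder_pos:
  fixes P :: "real measure" and w :: "nat \<Rightarrow> real \<Rightarrow> real"
  assumes ch: "chebyshev cs n w" and len: "length cs = n"
    and contw: "\<And>j s. j \<le> n \<Longrightarrow> isCont (w j) s"
    and r: "diff_op cs r \<rho>" "\<And>s. \<rho> s > 0" "\<And>s. isCont r s"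
    and \<kappa>: "\<And>s. \<kappa> s > 0"
    and int: "\<And>j. j \<le> n \<Longrightarrow> integrable P (\<lambda>s. w j s * r s * \<kappa> s)"
    and orth: "\<And>j. j < n \<Longrightarrow> (\<integral>s. w j s * r s * \<kappa> s \<partial>P) = 0"
    and supp: "\<And>h :: real \<Rightarrow> real. (\<And>s. isCont h s) \<Longrightarrow> AE s in P. h s = 0 \<Longrightarrow> finite {s. h s = 0} \<Longrightarrow>
      card {s. h s = 0} > n"
  shows "(\<integral>s. w n s * r s * \<kappa> s \<partial>P) > 0"
proof -
  define Z where "Z = {s. r s = 0}"
  have Z: "finite Z" "card Z \<le> n"
    using card_zeros_diff_op[OF r(1)] r(2) len by (auto simp: Z_def less_imp_neq[symmetric])
  define A where "A = {z \<in> Z. changes_sign r z}"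
  define k where "k = card A"
  have A: "A \<subseteq> Z" "finite A" using Z by (auto simp: A_def intro: finite_subset)
  have k: "k \<le> n" using card_mono[OF Z(1) A(1)] Z(2) by (simp add: k_def)
  \<comment> \<open>There are \<open>k + 1\<close> functions and only \<open>k\<close> vanishing
    conditions.\<close>
  obtain b where b: "\<exists>j\<in>{..k}. b j \<noteq> 0" "\<And>a. a \<in> A \<Longrightarrow> (\<Sum>j\<le>k. b j * w j a) = 0"
    using exists_vanishing_lincomb[OF A(2), of "{..k}" w] by (auto simp: k_def)
  define T where "T s = (\<Sum>j\<le>k. b j * w j s)" for s
  have T0: "finite {s. T s = 0}" "card {s. T s = 0} \<le> k"
    using chebyshev_zeros[OF ch k, of b] b(1) by (auto simp: T_def)
  have AT: "{s. T s = 0} = A"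
    using card_seteq[OF T0(1), of A] b(2) T0(2) by (auto simp: T_def k_def)
  have bk: "b k \<noteq> 0"
    using chebyshev_zeros(3)[OF ch k, of b] b(1) AT len by (auto simp: T_def k_def)
  obtain \<omega> where \<omega>: "\<And>s. \<omega> s > 0" "diff_op (take k cs) T (\<lambda>s. b k * \<omega> s)"
    using chebyshev_lincomb[of cs n w k b, OF ch k bk] by (auto simp: T_def[abs_def])
  have contT: "isCont T s" for s
    unfolding T_def using contw k by (intro continuous_intros) auto
  have intT: "integrable P (\<lambda>s. T s * r s * \<kappa> s)"
    and int_eq: "(\<integral>s. T s * r s * \<kappa> s \<partial>P) = (\<Sum>j\<le>k. b j * (\<integral>s. w j s * r s * \<kappa> s \<partial>P))"
  proof -
    have eq: "(\<lambda>s. T s * r s * \<kappa> s) = (\<lambda>s. \<Sum>j\<le>k. b j * (w j s * r s * \<kappa> s))"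
      by (simp add: T_def sum_distrib_right mult.assoc)
    show "integrable P (\<lambda>s. T s * r s * \<kappa> s)" 
      unfolding eq using int k by (intro Bochner_Integration.integrable_sum) auto
    show "(\<integral>s. T s * r s * \<kappa> s \<partial>P) = (\<Sum>j\<le>k. b j * (\<integral>s. w j s * r s * \<kappa> s \<partial>P))"
      unfolding eq using int k by (subst Bochner_Integration.integral_sum) auto
  qed
  \<comment> \<open>All zeros of \<open>T\<close> are zeros of \<open>r\<close>, so
    \<open>T * r\<close> has at most \<open>n\<close> zeros, which is too few for a continuous
    function vanishing almost everywhere by \<open>supp\<close>.\<close>
  have not_zero: "\<not> (AE s in P. T s * r s * \<kappa> s = 0)"
  proof
    assume "AE s in P. T s * r s * \<kappa> s = 0"
    then have "AE s in P. T s * r s = 0" using \<kappa> by (auto simp: less_imp_neq[symmetric])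
    moreover have eq: "{s. T s * r s = 0} = Z" using AT A(1) by (auto simp: Z_def)
    ultimately have "card Z > n"
      using supp[of "\<lambda>s. T s * r s"] contT r(3) Z(1) by (auto intro: continuous_intros)
    with Z(2) show False by simp
  qed
  have sums: "(\<integral>s. T s * r s * \<kappa> s \<partial>P) = (if k = n then b n * (\<integral>s. w n s * r s * \<kappa> s \<partial>P) else 0)"
  proof -
    have "(\<Sum>j\<le>k. b j * (\<integral>s. w j s * r s * \<kappa> s \<partial>P)) =
      (\<Sum>j\<le>k. if j = n then b n * (\<integral>s. w n s * r s * \<kappa> s \<partial>P) else 0)"
      using orth k by (intro sum.cong) auto
    then show ?thesis using k unfolding int_eq by auto
  qed
  show ?thesis
  proof (cases "k = n")
    case True
    \<comment> \<open>Division by \<open>b n\<close> is written as a combination with zero second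
      weight to match \<open>diff_op_lincomb\<close>; the image is then the positive function
      \<open>\<omega>\<close>.\<close>
    have D: "diff_op cs (\<lambda>s. (1 / b n) * T s + 0 * T s) (\<lambda>s. (1 / b n) * (b n * \<omega> s) + 0 * (b n * \<omega> s))"
      using \<omega>(2) True len by (intro diff_op_lincomb) auto
    have nonneg: "r s * (T s / b n) \<ge> 0" for s
      using same_zeros_same_sign[OF r(1) D r(2) _ A(2), of s] True \<omega>(1) bk AT A(1) len
      by (auto simp: k_def Z_def)
    have eq: "(\<lambda>s. r s * (T s / b n) * \<kappa> s) = (\<lambda>s. (1 / b n) * (T s * r s * \<kappa> s))" by auto
    have npos: "r s * (T s / b n) * \<kappa> s \<ge> 0" for s
      by (rule mult_nonneg_nonneg[OF nonneg less_imp_le[OF \<kappa>]])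
    have int': "integrable P (\<lambda>s. r s * (T s / b n) * \<kappa> s)" unfolding eq using intT by simp
    have "(\<integral>s. r s * (T s / b n) * \<kappa> s \<partial>P) > 0"
    proof -
      have "(\<integral>s. r s * (T s / b n) * \<kappa> s \<partial>P) \<noteq> 0"
      proof
        assume "(\<integral>s. r s * (T s / b n) * \<kappa> s \<partial>P) = 0"
        then have "AE s in P. r s * (T s / b n) * \<kappa> s = 0"
          using int' npos by (simp only: integral_nonneg_eq_0_iff_AE[OF int' AE_I2])
        then have "AE s in P. T s * r s * \<kappa> s = 0"
          by (rule AE_mp) (use bk True in auto)
        then show False using not_zero by simp
      qed
      moreover have "(\<integral>s. r s * (T s / b n) * \<kappa> s \<partial>P) \<ge> 0"
        using npos by (intro integral_nonneg_AE AE_I2)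
      ultimately show ?thesis by linarith
    qed
    also have "(\<integral>s. r s * (T s / b n) * \<kappa> s \<partial>P) = (\<integral>s. w n s * r s * \<kappa> s \<partial>P)"
      unfolding eq using sums True bk by simp
    finally show ?thesis .
  next
    case False
    \<comment> \<open>At points of \<open>A\<close> both factors change sign, since the zeros of
      \<open>T\<close> are simple by maximality of their number. Elsewhere \<open>T\<close> is
      nonzero, and \<open>r\<close> either is nonzero or has a zero without sign change.\<close>
    have keep: "keeps_sign (\<lambda>s. T s * r s) s" for s
    proof (cases "s \<in> A")
      case True
      have "card {s. T s = 0} = length (take k cs)" using AT k len by (simp add: k_def)
      then obtain d where "d \<noteq> 0" "(T has_real_derivative d) (at s)"
        using simple_zeros_diff_op[OF \<omega>(2)] \<omega>(1) bk True AT
        by (auto simp: less_imp_neq[symmetric])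
      then have "changes_sign T s" using changes_sign_simple_zero True AT by blast
      with True show ?thesis by (intro keeps_sign_mult) (auto simp: A_def)
    next
      case s: False
      then have "keeps_sign T s" using keeps_sign_nonzero[OF contT] AT by blast
      moreover have "keeps_sign r s"
      proof (cases "s \<in> Z")
        case True
        then show ?thesis using changes_or_keeps_sign[OF r(3), of s] Z(1) s by (auto simp: A_def Z_def)
      next
        case False
        then show ?thesis using keeps_sign_nonzero[OF r(3)] by (auto simp: Z_def)
      qed
      ultimately show ?thesis by (intro keeps_sign_mult) auto
    qed
    have int0: "(\<integral>s. T s * r s * \<kappa> s \<partial>P) = 0" using sums False by simp
    have "(\<forall>s. T s * r s \<ge> 0) \<or> (\<forall>s. T s * r s \<le> 0)"
      using keeps_sign_constant[of "\<lambda>s. T s * r s"] keep contT r(3) by (auto intro: continuous_intros)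
    then have "AE s in P. T s * r s * \<kappa> s = 0"
    proof
      assume "\<forall>s. T s * r s \<ge> 0"
      then show ?thesis using int0 intT \<kappa>
        by (subst (asm) integral_nonneg_eq_0_iff_AE) (auto simp: less_imp_le)
    next
      assume np: "\<forall>s. T s * r s \<le> 0"
      have "AE s in P. - (T s * r s * \<kappa> s) = 0"
        using int0 intT \<kappa> np by (subst integral_nonneg_eq_0_iff_AE[symmetric])
          (auto simp: less_imp_le mult_nonpos_nonneg)
      then show ?thesis by simp
    qed
    with not_zero show ?thesis by simp
  qed
qed

section \<open>Differentiation under the integral and projections in \<open>L2\<close>\<close>

lemma power_le_fact_mult_exp:
  fixes y :: real
  assumes "y \<ge> 0"
  shows "y ^ n \<le> fact n * exp y"
proof -
  have "(\<Sum>k\<in>{n}. inverse (fact k) * y ^ k) \<le> (\<Sum>k. inverse (fact k) * y ^ k)"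
    using assms by (intro sum_le_suminf summable_exp) auto
  then have "inverse (fact n) * y ^ n \<le> exp y" by (simp add: exp_def divide_inverse mult.commute)
  then show ?thesis by (simp add: field_simps)
qed

lemma DERIV_quadratic_remainder:
  fixes F :: "real \<Rightarrow> real"
  assumes "\<And>y. \<bar>y - x\<bar> \<le> 1 \<Longrightarrow> \<bar>F y - F x - (y - x) * D\<bar> \<le> K * (y - x)\<^sup>2"
  shows "(F has_real_derivative D) (at x)"
proof -
  have "((\<lambda>y. (F y - F x) / (y - x) - D) \<longlongrightarrow> 0) (at x)"
  proof (rule Lim_null_comparison)
    have "\<bar>(F y - F x) / (y - x) - D\<bar> \<le> K * \<bar>y - x\<bar>" if "y \<noteq> x" "dist y x < 1" for y
    proof -
      have "(F y - F x) / (y - x) - D = (F y - F x - (y - x) * D) / (y - x)"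
        using that by (simp add: field_simps)
      also have "\<bar>\<dots>\<bar> \<le> (K * (y - x)\<^sup>2) / \<bar>y - x\<bar>"
        using assms[of y] that by (auto simp: dist_real_def intro!: divide_right_mono)
      also have "(y - x)\<^sup>2 = \<bar>y - x\<bar> * \<bar>y - x\<bar>" by (simp add: power2_eq_square)
      also have "K * (\<bar>y - x\<bar> * \<bar>y - x\<bar>) / \<bar>y - x\<bar> = K * \<bar>y - x\<bar>"
        using that by (simp del: abs_mult_self_eq)
      finally show ?thesis .
    qed
    then show "\<forall>\<^sub>F y in at x. norm ((F y - F x) / (y - x) - D) \<le> K * \<bar>y - x\<bar>"
      unfolding eventually_at real_norm_def by (intro exI[of _ 1]) auto
    show "((\<lambda>y. K * \<bar>y - x\<bar>) \<longlongrightarrow> 0) (at x)"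
      by (auto intro!: tendsto_eq_intros)
  qed
  then show ?thesis unfolding has_field_derivative_iff using LIM_zero_iff by blast
qed

text \<open>Here \<open>u k\<close> is the \<open>k\<close>-th derivative of \<open>u 0\<close> in
  the parameter. The bounds are uniform in \<open>s\<close> and local in the parameter, which serves
  both differentiation under the integral and differentiation in the norm of
  \<open>L2\<close>.\<close>

definition bounded_jet :: "(nat \<Rightarrow> real \<Rightarrow> real \<Rightarrow> real) \<Rightarrow> bool" where
  "bounded_jet u \<longleftrightarrow>
     (\<forall>k x s. ((\<lambda>y. u k y s) has_real_derivative u (Suc k) x s) (at x)) \<and>
     (\<forall>k R. \<exists>C. \<forall>x s. \<bar>x\<bar> \<le> R \<longrightarrow> \<bar>u k x s\<bar> \<le> C) \<and>
     (\<forall>k x. u k x \<in> borel_measurable borel)"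

text \<open>The mean value theorem replaces the increment by a derivative at an intermediate point,
  and the bound on the second derivative makes the first one Lipschitz. The constant does not depend
  on \<open>s\<close>.\<close>

lemma bounded_jet_remainder:
  assumes "bounded_jet u"
  shows "\<exists>C\<ge>0. \<forall>x y s. \<bar>x\<bar> \<le> R \<longrightarrow> \<bar>y\<bar> \<le> R \<longrightarrow>
    \<bar>u k y s - u k x s - (y - x) * u (Suc k) x s\<bar> \<le> C * (y - x)\<^sup>2"
proof -
  obtain C where C: "\<And>x s. \<bar>x\<bar> \<le> R \<Longrightarrow> \<bar>u (Suc (Suc k)) x s\<bar> \<le> C"
    using assms unfolding bounded_jet_def by metis
  have d: "((\<lambda>y. u k y s) has_real_derivative u (Suc k) x s) (at x)" for k x s
    using assms unfolding bounded_jet_def by blast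
  have lip: "\<bar>u (Suc k) y s - u (Suc k) x s\<bar> \<le> C * \<bar>y - x\<bar>" if "\<bar>x\<bar> \<le> R" "\<bar>y\<bar> \<le> R" for x y s
  proof -
    have "norm (u (Suc k) y s - u (Suc k) x s) \<le> C * norm (y - x)"
    proof (rule field_differentiable_bound[of "{-R..R}"])
      fix z assume "z \<in> {-R..R}"
      then show "norm (u (Suc (Suc k)) z s) \<le> C" using C by (simp add: abs_le_iff)
      show "((\<lambda>y. u (Suc k) y s) has_field_derivative u (Suc (Suc k)) z s) (at z within {-R..R})"
        using d has_field_derivative_at_within by blast
    qed (use that in auto)
    then show ?thesis by simp
  qed
  \<comment> \<open>The absolute value of \<open>C\<close> covers negative \<open>R\<close>, for
    which the bound defining \<open>C\<close> is vacuous.\<close>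
  have "\<bar>u k y s - u k x s - (y - x) * u (Suc k) x s\<bar> \<le> \<bar>C\<bar> * (y - x)\<^sup>2"
    if xy: "\<bar>x\<bar> \<le> R" "\<bar>y\<bar> \<le> R" for x y s
  proof (cases "x = y")
    case False
    obtain z where z: "min x y < z" "z < max x y" "u k y s - u k x s = (y - x) * u (Suc k) z s"
    proof (cases "x < y")
      case True
      then show ?thesis
        using MVT2[of x y "\<lambda>y. u k y s" "\<lambda>y. u (Suc k) y s"] d that by auto
    next
      case False
      then have "y < x" using \<open>x \<noteq> y\<close> by simp
      then obtain z where "y < z" "z < x" "u k x s - u k y s = (x - y) * u (Suc k) z s"
        using MVT2[of y x "\<lambda>y. u k y s" "\<lambda>y. u (Suc k) y s"] d by blast
      with \<open>y < x\<close> show ?thesis by (intro that[of z]) (auto simp: algebra_simps)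
    qed
    have "\<bar>u k y s - u k x s - (y - x) * u (Suc k) x s\<bar> = \<bar>y - x\<bar> * \<bar>u (Suc k) z s - u (Suc k) x s\<bar>"
      unfolding z(3) by (simp add: abs_mult[symmetric] algebra_simps)
    also have "\<dots> \<le> \<bar>y - x\<bar> * (\<bar>C\<bar> * \<bar>y - x\<bar>)"
    proof (intro mult_left_mono)
      have "\<bar>u (Suc k) z s - u (Suc k) x s\<bar> \<le> C * \<bar>z - x\<bar>" using lip[of x z s] xy z by auto
      also have "\<dots> \<le> \<bar>C\<bar> * \<bar>y - x\<bar>" using z by (intro mult_mono) auto
      finally show "\<bar>u (Suc k) z s - u (Suc k) x s\<bar> \<le> \<bar>C\<bar> * \<bar>y - x\<bar>" .
    qed simp
    also have "\<dots> = \<bar>C\<bar> * (y - x)\<^sup>2" by (simp add: power2_eq_square)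
    finally show ?thesis .
  qed simp
  then show ?thesis by (intro exI[of _ "\<bar>C\<bar>"]) auto
qed

lemma bounded_jet_integrable:
  assumes u: "bounded_jet u" and M: "\<And>f :: real \<Rightarrow> real. f \<in> borel_measurable borel \<Longrightarrow> f \<in> borel_measurable M"
    and p: "integrable M p"
  shows "integrable M (\<lambda>s. u k x s * (p s :: real))"
proof -
  obtain C where C: "\<And>s. \<bar>u k x s\<bar> \<le> C"
    using u unfolding bounded_jet_def by (metis order_refl)
  have [measurable]: "u k x \<in> borel_measurable M" by (rule M) (use u in \<open>auto simp: bounded_jet_def\<close>)
  have [measurable]: "p \<in> borel_measurable M" using p by simp
  show ?thesis
  proof (rule Bochner_Integration.integrable_bound[OF integrable_mult_right[OF p, of C]])
    show "AE s in M. norm (u k x s * p s) \<le> norm (C * p s)"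
      using C by (intro AE_I2) (auto simp: abs_mult intro!: mult_right_mono order.trans[OF C abs_ge_self])
  qed simp
qed

text \<open>A quadratic remainder that is uniform in \<open>s\<close> stays quadratic after
  integration against \<open>\<bar>p\<bar>\<close>.\<close>

lemma bounded_jet_integral_deriv:
  assumes u: "bounded_jet u" and M: "\<And>f :: real \<Rightarrow> real. f \<in> borel_measurable borel \<Longrightarrow> f \<in> borel_measurable M"
    and p: "integrable M p"
  shows "((\<lambda>y. \<integral>s. u k y s * (p s :: real) \<partial>M) has_real_derivative
     (\<integral>s. u (Suc k) x s * p s \<partial>M)) (at x)"
proof -
  obtain C where C: "C \<ge> 0" "\<And>y s. \<bar>y\<bar> \<le> \<bar>x\<bar> + 1 \<Longrightarrow>
      \<bar>u k y s - u k x s - (y - x) * u (Suc k) x s\<bar> \<le> C * (y - x)\<^sup>2"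
    using bounded_jet_remainder[OF u, of "\<bar>x\<bar> + 1" k] by auto
  note int = bounded_jet_integrable[OF u M p]
  have pint: "integrable M (\<lambda>s. \<bar>p s\<bar>)" using p by simp
  show ?thesis
  proof (rule DERIV_quadratic_remainder)
    fix y assume y: "\<bar>y - x\<bar> \<le> 1"
    note i1 = int[of k y] and i2 = int[of k x]
      and i3 = integrable_mult_right[OF int[of "Suc k" x], of "y - x"]
    have eq: "(\<lambda>s. (u k y s - u k x s - (y - x) * u (Suc k) x s) * p s) =
      (\<lambda>s. u k y s * p s - u k x s * p s - (y - x) * (u (Suc k) x s * p s))"
      by (auto simp: algebra_simps)
    have diff: "(\<integral>s. u k y s * p s \<partial>M) - (\<integral>s. u k x s * p s \<partial>M) - (y - x) * (\<integral>s. u (Suc k) x s * p s \<partial>M)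
      = (\<integral>s. (u k y s - u k x s - (y - x) * u (Suc k) x s) * p s \<partial>M)"
      unfolding eq
      by (simp only: Bochner_Integration.integral_diff[OF Bochner_Integration.integrable_diff[OF i1 i2] i3]
          Bochner_Integration.integral_diff[OF i1 i2] integral_mult_right_zero)
    have "\<bar>\<integral>s. (u k y s - u k x s - (y - x) * u (Suc k) x s) * p s \<partial>M\<bar> \<le> (\<integral>s. \<bar>(u k y s - u k x s - (y - x) * u (Suc k) x s) * p s\<bar> \<partial>M)"
      by (rule integral_abs_bound)
    also have "\<dots> \<le> (\<integral>s. (C * (y - x)\<^sup>2) * \<bar>p s\<bar> \<partial>M)"
    proof (rule integral_mono)
      show "integrable M (\<lambda>s. \<bar>(u k y s - u k x s - (y - x) * u (Suc k) x s) * p s\<bar>)"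
        by (intro integrable_abs, unfold eq) (intro Bochner_Integration.integrable_diff i1 i2 i3)
      show "integrable M (\<lambda>s. (C * (y - x)\<^sup>2) * \<bar>p s\<bar>)"
        using pint by (rule integrable_mult_right)
      show "\<bar>(u k y s - u k x s - (y - x) * u (Suc k) x s) * p s\<bar> \<le> (C * (y - x)\<^sup>2) * \<bar>p s\<bar>" for s
        unfolding abs_mult[of _ "p s"] using C(2)[of y s] y by (intro mult_right_mono) linarith+
    qed
    also have "\<dots> = (C * (\<integral>s. \<bar>p s\<bar> \<partial>M)) * (y - x)\<^sup>2" by (simp add: mult_ac)
    finally show "\<bar>(\<integral>s. u k y s * p s \<partial>M) - (\<integral>s. u k x s * p s \<partial>M) - (y - x) * (\<integral>s. u (Suc k) x s * p s \<partial>M)\<bar>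
      \<le> (C * (\<integral>s. \<bar>p s\<bar> \<partial>M)) * (y - x)\<^sup>2" unfolding diff .
  qed
qed

text \<open>The power is absorbed by \<open>fact j * exp (2 * \<bar>s\<bar>)\<close>, which raises
  the linear coefficient from \<open>2 * R\<close> to \<open>2 * (R + 1)\<close>; completing the
  square bounds the remaining exponent.\<close>

lemma gauss_kernel_bound:
  fixes \<kappa> R :: real
  assumes "\<kappa> > 0" "\<bar>x\<bar> \<le> R"
  shows "\<bar>(2 * s) ^ j * exp (2 * x * s - \<kappa> * s\<^sup>2)\<bar> \<le> fact j * exp ((R + 1)\<^sup>2 / \<kappa>)"
proof -
  have R: "R \<ge> 0" using assms by simp
  have "(2 * \<bar>s\<bar>) ^ j \<le> fact j * exp (2 * \<bar>s\<bar>)" by (rule power_le_fact_mult_exp) simp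
  moreover have "exp (2 * x * s - \<kappa> * s\<^sup>2) \<le> exp (2 * R * \<bar>s\<bar> - \<kappa> * s\<^sup>2)"
  proof -
    have "x * s \<le> \<bar>x\<bar> * \<bar>s\<bar>" by (simp flip: abs_mult)
    also have "\<dots> \<le> R * \<bar>s\<bar>" using assms by (intro mult_right_mono) auto
    finally show ?thesis by simp
  qed
  ultimately have "(2 * \<bar>s\<bar>) ^ j * exp (2 * x * s - \<kappa> * s\<^sup>2) \<le>
      (fact j * exp (2 * \<bar>s\<bar>)) * exp (2 * R * \<bar>s\<bar> - \<kappa> * s\<^sup>2)"
    by (intro mult_mono) auto
  also have "\<dots> = fact j * exp (2 * (R + 1) * \<bar>s\<bar> - \<kappa> * s\<^sup>2)"
    by (simp add: exp_add[symmetric] algebra_simps)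
  also have "2 * (R + 1) * \<bar>s\<bar> - \<kappa> * s\<^sup>2 \<le> (R + 1)\<^sup>2 / \<kappa>"
  proof -
    have "0 \<le> (\<kappa> * \<bar>s\<bar> - (R + 1))\<^sup>2" by simp
    also have "\<dots> = \<kappa> * (\<kappa> * s\<^sup>2 - 2 * (R + 1) * \<bar>s\<bar>) + (R + 1)\<^sup>2"
      by (simp add: power2_eq_square algebra_simps flip: abs_mult)
    finally show ?thesis using assms(1) by (simp add: field_simps)
  qed
  finally show ?thesis by (simp add: abs_mult power_abs)
qed

text \<open>The value \<open>\<kappa> = 1\<close> serves the atoms, and
  \<open>\<kappa> = 1/2\<close> serves the integral representation of
  \<open>exp (s\<^sup>2)\<close>.\<close>

lemma bounded_jet_gauss_kernel:
  assumes "\<kappa> > 0"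
  shows "bounded_jet (\<lambda>j x s. (2 * s) ^ j * exp (2 * x * s - \<kappa> * s\<^sup>2))"
  unfolding bounded_jet_def
proof (intro conjI allI)
  show "((\<lambda>y. (2 * s) ^ k * exp (2 * y * s - \<kappa> * s\<^sup>2)) has_real_derivative
      (2 * s) ^ Suc k * exp (2 * x * s - \<kappa> * s\<^sup>2)) (at x)" for k x s
    by (auto intro!: derivative_eq_intros)
  show "\<exists>C. \<forall>x s. \<bar>x\<bar> \<le> R \<longrightarrow> \<bar>(2 * s) ^ k * exp (2 * x * s - \<kappa> * s\<^sup>2)\<bar> \<le> C" for k R
    using gauss_kernel_bound[OF assms] by blast
qed simp

section \<open>Inner products and orthogonal projections in \<open>L2\<close>\<close>

lemma L2_mult_integrable:
  assumes "f \<in> L2 P" "g \<in> L2 P"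
  shows "integrable P (\<lambda>s. f s * g s)"
proof -
  have [measurable]: "f \<in> borel_measurable P" "g \<in> borel_measurable P" 
    using assms by (auto simp: L2_def)
  have i: "integrable P (\<lambda>s. (f s)\<^sup>2 + (g s)\<^sup>2)"
    using assms by (intro Bochner_Integration.integrable_add) (auto simp: L2_def)
  show ?thesis
  proof (rule Bochner_Integration.integrable_bound[OF i])
    have "\<bar>a * b\<bar> \<le> a\<^sup>2 + b\<^sup>2" for a b :: real
      proof -
      have "0 \<le> (\<bar>a\<bar> - \<bar>b\<bar>)\<^sup>2 + \<bar>a\<bar>\<^sup>2 + \<bar>b\<bar>\<^sup>2" by simp
      then show ?thesis unfolding power2_diff power2_abs abs_mult by simp
    qed
    then show "AE s in P. norm (f s * g s) \<le> norm ((f s)\<^sup>2 + (g s)\<^sup>2)"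
      by (intro AE_I2) (simp add: abs_of_nonneg)
  qed simp
qed

lemma L2_lincomb:
  assumes "f \<in> L2 P" "g \<in> L2 P"
  shows "(\<lambda>s. a * f s + b * g s) \<in> L2 P"
proof -
  have "(\<lambda>s. (a * f s + b * g s)\<^sup>2) = (\<lambda>s. a\<^sup>2 * (f s)\<^sup>2 + b\<^sup>2 * (g s)\<^sup>2 + 2 * a * b * (f s * g s))"
    by (auto simp: power2_eq_square algebra_simps)
  with assms L2_mult_integrable[OF assms] show ?thesis by (auto simp: L2_def)
qed

lemma L2_diff: "f \<in> L2 P \<Longrightarrow> g \<in> L2 P \<Longrightarrow> (\<lambda>s. f s - g s) \<in> L2 P"
  using L2_lincomb[of f P g 1 "-1"] by simp

lemma L2_scale: "f \<in> L2 P \<Longrightarrow> (\<lambda>s. a * f s) \<in> L2 P"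
  using L2_lincomb[of f P f a 0] by simp

lemma L2_sum:
  assumes "finite J" "\<And>j. j \<in> J \<Longrightarrow> e j \<in> L2 P"
  shows "(\<lambda>s. \<Sum>j\<in>J. b j * e j s) \<in> L2 P"
  using assms
proof (induction J rule: finite_induct)
  case empty
  then show ?case by (simp add: L2_def)
next
  case (insert i J)
  then have "(\<lambda>s. b i * e i s + 1 * (\<Sum>j\<in>J. b j * e j s)) \<in> L2 P"
    by (intro L2_lincomb) auto
  with insert show ?case by simp
qed

lemma L2_inner_commute: "L2_inner P f g = L2_inner P g f"
  by (simp add: L2_inner_def mult.commute)

lemma L2_inner_lincomb_right:
  assumes "f \<in> L2 P" "g \<in> L2 P" "h \<in> L2 P"
  shows "L2_inner P h (\<lambda>s. a * f s + b * g s) = a * L2_inner P h f + b * L2_inner P h g"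
proof -
  have "(\<lambda>s. h s * (a * f s + b * g s)) = (\<lambda>s. a * (h s * f s) + b * (h s * g s))"
    by (auto simp: algebra_simps)
  then show ?thesis using assms by (simp add: L2_inner_def L2_mult_integrable)
qed

lemma L2_inner_diff_right:
  assumes "f \<in> L2 P" "g \<in> L2 P" "h \<in> L2 P"
  shows "L2_inner P h (\<lambda>s. f s - g s) = L2_inner P h f - L2_inner P h g"
  using L2_inner_lincomb_right[OF assms, of 1 "-1"] by simp

lemma L2_inner_sum_right:
  assumes "finite J" "\<And>j. j \<in> J \<Longrightarrow> e j \<in> L2 P" "h \<in> L2 P"
  shows "L2_inner P h (\<lambda>s. \<Sum>j\<in>J. b j * e j s) = (\<Sum>j\<in>J. b j * L2_inner P h (e j))"
proof -
  have "(\<lambda>s. h s * (\<Sum>j\<in>J. b j * e j s)) = (\<lambda>s. \<Sum>j\<in>J. b j * (h s * e j s))"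
    by (auto simp: sum_distrib_left algebra_simps)
  then show ?thesis using assms by (simp add: L2_inner_def L2_mult_integrable)
qed

lemma L2_inner_cong_AE:
  assumes "AE s in P. f s = f' s" "AE s in P. g s = g' s"
    and "f \<in> L2 P" "f' \<in> L2 P" "g \<in> L2 P" "g' \<in> L2 P"
  shows "L2_inner P f g = L2_inner P f' g'"
  unfolding L2_inner_def
proof (rule integral_cong_AE)
  show "AE s in P. f s * g s = f' s * g' s" using assms(1,2) by eventually_elim simp
qed (use assms in \<open>auto simp: L2_def intro!: borel_measurable_times\<close>)

lemma L2_inner_self_nonneg: "L2_inner P f f \<ge> 0"
  by (simp add: L2_inner_def)

lemma L2_inner_self_eq_0:
  assumes "f \<in> L2 P" "L2_inner P f f = 0"
  shows "AE s in P. f s = 0"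
  using assms(2) L2_mult_integrable[OF assms(1,1)] unfolding L2_inner_def
  by (subst (asm) integral_nonneg_eq_0_iff_AE) auto

text \<open>Gram-Schmidt by induction: \<open>f\<close> and \<open>e n\<close> are both reduced to
  residuals orthogonal to the first \<open>n\<close> functions, and the residual of \<open>f\<close>
  is then corrected along that of \<open>e n\<close>.\<close>

lemma L2_projection_exists:
  fixes e :: "nat \<Rightarrow> real \<Rightarrow> real"
  assumes "\<And>j. j < n \<Longrightarrow> e j \<in> L2 P" "f \<in> L2 P"
  shows "\<exists>\<alpha>. \<forall>j<n. L2_inner P (e j) (\<lambda>s. f s - (\<Sum>i<n. \<alpha> i * e i s)) = 0"
  using assms
proof (induction n arbitrary: f)
  case (Suc n)
  have e: "e j \<in> L2 P" if "j < Suc n" for j using Suc.prems(1) that .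
  have IH: "\<exists>\<alpha>. \<forall>j<n. L2_inner P (e j) (\<lambda>s. h s - (\<Sum>i<n. \<alpha> i * e i s)) = 0"
    if "h \<in> L2 P" for h
    by (rule Suc.IH) (auto intro: e that)
  obtain \<alpha> where \<alpha>: "\<And>j. j < n \<Longrightarrow> L2_inner P (e j) (\<lambda>s. f s - (\<Sum>i<n. \<alpha> i * e i s)) = 0"
    using IH[OF Suc.prems(2)] by blast
  obtain \<beta> where \<beta>: "\<And>j. j < n \<Longrightarrow> L2_inner P (e j) (\<lambda>s. e n s - (\<Sum>i<n. \<beta> i * e i s)) = 0"
    using IH[OF e[of n]] by blast
  define f' e' where "f' s = f s - (\<Sum>i<n. \<alpha> i * e i s)" and "e' s = e n s - (\<Sum>i<n. \<beta> i * e i s)" for s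
  have s: "(\<lambda>s. \<Sum>i<n. b i * e i s) \<in> L2 P" for b using e by (intro L2_sum) auto
  have f': "f' \<in> L2 P" and e': "e' \<in> L2 P"
    unfolding f'_def e'_def using s e Suc.prems(2) by (auto intro!: L2_diff)
  \<comment> \<open>If the residual \<open>e'\<close> has norm zero, then \<open>c = 0\<close> by
    the convention for division, and \<open>e'\<close> vanishes almost everywhere, so orthogonality
    to it is automatic.\<close>
  define c where "c = L2_inner P e' f' / L2_inner P e' e'"
  define \<gamma> where "\<gamma> i = (if i = n then c else \<alpha> i - c * \<beta> i)" for i
  have "(\<Sum>i<Suc n. \<gamma> i * e i s) = (\<Sum>i<n. \<alpha> i * e i s) + c * e' s" for s
    by (simp add: \<gamma>_def e'_def algebra_simps sum_subtractf sum_distrib_left)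
  then have g: "(\<lambda>s. f s - (\<Sum>i<Suc n. \<gamma> i * e i s)) = (\<lambda>s. 1 * f' s + (- c) * e' s)"
    by (auto simp: f'_def)
  define h where "h = (\<lambda>s. 1 * f' s + (- c) * e' s)"
  have h: "h \<in> L2 P" unfolding h_def by (intro L2_lincomb f' e')
  have low: "L2_inner P (e j) h = 0" if "j < n" for j
    using \<alpha>[OF that] \<beta>[OF that] L2_inner_lincomb_right[OF f' e' e[of j], of 1 "-c"] that
    by (simp add: f'_def[abs_def] e'_def[abs_def] h_def)
  have e'_perp: "L2_inner P e' h = 0"
  proof (cases "L2_inner P e' e' = 0")
    case True
    then have "AE s in P. e' s = 0" using L2_inner_self_eq_0[OF e'] by blast
    then have "AE s in P. e' s * h s = 0" by eventually_elim simp
    then show ?thesis unfolding L2_inner_def by (rule integral_eq_zero_AE)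
  next
    case False
    then show ?thesis using L2_inner_lincomb_right[OF f' e' e', of 1 "-c"] by (simp add: c_def h_def)
  qed
  have en: "e n = (\<lambda>s. 1 * e' s + 1 * (\<Sum>i<n. \<beta> i * e i s))" by (auto simp: e'_def)
  have "L2_inner P (e n) h = 0"
  proof -
    have "L2_inner P h (e n) = L2_inner P h e' + (\<Sum>i<n. \<beta> i * L2_inner P h (e i))"
      using L2_inner_lincomb_right[OF e' s h, of 1 1 \<beta>] L2_inner_sum_right[of "{..<n}" e P h \<beta>] e h
      by (subst en) simp
    also have "\<dots> = 0" using e'_perp low by (simp add: L2_inner_commute[of P h])
    finally show ?thesis by (simp add: L2_inner_commute)
  qed
  with low have "\<forall>j<Suc n. L2_inner P (e j) (\<lambda>s. f s - (\<Sum>i<Suc n. \<gamma> i * e i s)) = 0"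
    unfolding g h_def[symmetric] by (auto simp: less_Suc_eq)
  then show ?case by blast
qed simp

text \<open>The affine constraint set contains \<open>f\<close>, so its point of minimal norm is the orthogonal
  projection of \<open>f\<close> onto the span of the representers.\<close>

lemma L2_arg_min_eq_projection:
  fixes e :: "nat \<Rightarrow> real \<Rightarrow> real"
  assumes e: "\<And>j. j < n \<Longrightarrow> e j \<in> L2 P" and f: "f \<in> L2 P"
  defines "C \<equiv> {p \<in> L2 P. \<forall>j<n. L2_inner P (e j) p = L2_inner P (e j) f}"
  shows "arg_min_on (L2_norm P) C \<in> C"
    and "\<exists>\<alpha>. (AE s in P. arg_min_on (L2_norm P) C s = (\<Sum>i<n. \<alpha> i * e i s)) \<and>
      (\<forall>j<n. L2_inner P (e j) (\<lambda>s. f s - (\<Sum>i<n. \<alpha> i * e i s)) = 0)"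
proof -
  obtain \<alpha> where \<alpha>: "\<And>j. j < n \<Longrightarrow> L2_inner P (e j) (\<lambda>s. f s - (\<Sum>i<n. \<alpha> i * e i s)) = 0"
    using L2_projection_exists[of n e P f, OF e f] by auto
  define q where "q s = (\<Sum>i<n. \<alpha> i * e i s)" for s
  have q: "q \<in> L2 P" unfolding q_def using e by (intro L2_sum) auto
  have qC: "q \<in> C" unfolding C_def
    using q \<alpha> L2_inner_diff_right[OF f q e] by (auto simp flip: q_def)
  have pyth: "L2_inner P p p = L2_inner P q q + L2_inner P (\<lambda>s. p s - q s) (\<lambda>s. p s - q s)"
    if p: "p \<in> C" for p
  proof -
    have pL: "p \<in> L2 P" using p by (simp add: C_def)
    define d where "d s = p s - q s" for s
    have d: "d \<in> L2 P" unfolding d_def by (intro L2_diff pL q)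
    have "L2_inner P (e j) d = 0" if "j < n" for j
      using p qC that L2_inner_diff_right[OF pL q e[OF that]] by (simp add: C_def flip: d_def)
    then have "L2_inner P d q = 0" unfolding q_def[abs_def]
      using L2_inner_sum_right[of "{..<n}" e P d \<alpha>] e d by (simp add: L2_inner_commute[of P d])
    then have qd: "L2_inner P q d = 0" "L2_inner P d q = 0" by (simp_all add: L2_inner_commute)
    have p_eq: "p = (\<lambda>s. q s + d s)" by (auto simp: d_def)
    have split: "L2_inner P h p = L2_inner P h q + L2_inner P h d" if "h \<in> L2 P" for h
      using L2_inner_lincomb_right[OF q d that, of 1 1] unfolding mult_1 p_eq[symmetric] .
    have "L2_inner P p p = L2_inner P q p + L2_inner P d p"
      using split[OF pL] by (simp add: L2_inner_commute)
    also have "\<dots> = L2_inner P q q + L2_inner P d d" using split[OF q] split[OF d] qd by simp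
    finally show ?thesis by (simp add: d_def[abs_def])
  qed
  have min: "is_arg_min (L2_norm P) (\<lambda>x. x \<in> C) q"
  proof -
    have "L2_norm P q \<le> L2_norm P p" if "p \<in> C" for p
      unfolding L2_norm_def using pyth[OF that] L2_inner_self_nonneg[of P "\<lambda>s. p s - q s"]
      by (intro real_sqrt_le_mono) linarith
    with qC show ?thesis unfolding is_arg_min_linorder by blast
  qed
  define p where "p = arg_min_on (L2_norm P) C"
  \<comment> \<open>\<open>arg_min_on\<close> is a choice among minimizers. The projection
    \<open>q\<close> is one, so the chosen \<open>p\<close> is one as well, and Pythagoras makes the
    distance between them zero.\<close>
  have pmin: "is_arg_min (L2_norm P) (\<lambda>x. x \<in> C) p"
    unfolding p_def arg_min_on_def arg_min_def by (rule someI[of _ q]) (rule min)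
  then have pC: "p \<in> C" by (simp add: is_arg_min_linorder)
  then show "arg_min_on (L2_norm P) C \<in> C" by (simp add: p_def)
  have pL: "p \<in> L2 P" using pC by (simp add: C_def)
  have "L2_norm P p \<le> L2_norm P q" using pmin qC by (simp add: is_arg_min_linorder)
  then have "L2_inner P p p \<le> L2_inner P q q" by (simp add: L2_norm_def)
  then have "L2_inner P (\<lambda>s. p s - q s) (\<lambda>s. p s - q s) = 0"
    using pyth[OF pC] L2_inner_self_nonneg[of P "\<lambda>s. p s - q s"]
    by linarith
  then have "AE s in P. p s - q s = 0" by (intro L2_inner_self_eq_0 L2_diff pL q)
  then have "AE s in P. p s = (\<Sum>i<n. \<alpha> i * e i s)" by eventually_elim (simp add: q_def)
  with \<alpha> show "\<exists>\<alpha>. (AE s in P. arg_min_on (L2_norm P) C s = (\<Sum>i<n. \<alpha> i * e i s)) \<and>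
      (\<forall>j<n. L2_inner P (e j) (\<lambda>s. f s - (\<Sum>i<n. \<alpha> i * e i s)) = 0)"
    unfolding p_def by blast
qed

section \<open>The normalized Gaussian atoms\<close>

text \<open>For every difference quotient \<open>q\<close>, the squared norm of \<open>g - h\<close>
  is at most twice the sum of the squared norms of \<open>q - g\<close> and \<open>q - h\<close>.
  Both tend to 0 along a nontrivial filter.\<close>

lemma L2_has_deriv_unique:
  assumes "L2_has_deriv P X u g x" "L2_has_deriv P X u h x" "x \<in> X" "at x within X \<noteq> bot"
  shows "AE s in P. g s = h s"
proof -
  have L: "g \<in> L2 P" "h \<in> L2 P" "\<And>y. y \<in> X \<Longrightarrow> u y \<in> L2 P"
    using assms by (auto simp: L2_has_deriv_def)
  define N where "N w y = L2_norm P (\<lambda>s. (u y s - u x s) / (y - x) - w s)" for w y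
  have lim: "(N g \<longlongrightarrow> 0) (at x within X)" "(N h \<longlongrightarrow> 0) (at x within X)"
    using assms by (auto simp: L2_has_deriv_def N_def[abs_def])
  have gh: "(\<lambda>s. g s - h s) \<in> L2 P" using L by (intro L2_diff)
  have "L2_inner P (\<lambda>s. g s - h s) (\<lambda>s. g s - h s) \<le> 2 * (N g y)\<^sup>2 + 2 * (N h y)\<^sup>2" if "y \<in> X" for y
  proof -
    define q where "q s = (u y s - u x s) / (y - x)" for s
    have q: "q \<in> L2 P"
      using L2_scale[OF L2_diff[OF L(3)[OF that] L(3)[OF assms(3)]], of "1 / (y - x)"] by (simp add: q_def[abs_def])
    have qg: "(\<lambda>s. q s - g s) \<in> L2 P" and qh: "(\<lambda>s. q s - h s) \<in> L2 P" using q L by (auto intro: L2_diff)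
    have N: "(N w y)\<^sup>2 = (\<integral>s. (q s - w s) * (q s - w s) \<partial>P)" for w
      unfolding N_def L2_norm_def q_def[symmetric]
      using L2_inner_self_nonneg[of P "\<lambda>s. q s - w s"] by (simp add: L2_inner_def)
    have "(\<integral>s. (g s - h s) * (g s - h s) \<partial>P) \<le>
      (\<integral>s. 2 * ((q s - g s) * (q s - g s)) + 2 * ((q s - h s) * (q s - h s)) \<partial>P)"
    proof (rule integral_mono)
      show "integrable P (\<lambda>s. (g s - h s) * (g s - h s))" by (rule L2_mult_integrable[OF gh gh])
      show "integrable P (\<lambda>s. 2 * ((q s - g s) * (q s - g s)) + 2 * ((q s - h s) * (q s - h s)))"
        using L2_mult_integrable[OF qg qg] L2_mult_integrable[OF qh qh] by simp
      show "(g s - h s) * (g s - h s) \<le> 2 * ((q s - g s) * (q s - g s)) + 2 * ((q s - h s) * (q s - h s))" for s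
        using zero_le_square[of "(q s - g s) + (q s - h s)"] by (simp add: algebra_simps)
    qed
    then show ?thesis
      using L2_mult_integrable[OF qg qg] L2_mult_integrable[OF qh qh] by (simp add: N L2_inner_def)
  qed
  then have "\<forall>\<^sub>F y in at x within X.
      L2_inner P (\<lambda>s. g s - h s) (\<lambda>s. g s - h s) \<le> 2 * (N g y)\<^sup>2 + 2 * (N h y)\<^sup>2"
    by (simp add: eventually_at_filter)
  moreover have lim2: "((\<lambda>y. 2 * (N g y)\<^sup>2 + 2 * (N h y)\<^sup>2) \<longlongrightarrow> 2 * 0\<^sup>2 + 2 * 0\<^sup>2) (at x within X)"
    by (intro tendsto_intros lim)
  ultimately have "L2_inner P (\<lambda>s. g s - h s) (\<lambda>s. g s - h s) \<le> 2 * 0\<^sup>2 + 2 * 0\<^sup>2"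
    by (intro tendsto_lowerbound[OF lim2 _ assms(4)])
  then have "L2_inner P (\<lambda>s. g s - h s) (\<lambda>s. g s - h s) = 0"
    using L2_inner_self_nonneg[of P "\<lambda>s. g s - h s"] by simp
  then show ?thesis using L2_inner_self_eq_0[OF gh] by simp
qed

lemma L2_norm_cong_AE:
  assumes "AE s in P. f s = g s" "f \<in> L2 P" "g \<in> L2 P"
  shows "L2_norm P f = L2_norm P g"
  unfolding L2_norm_def using L2_inner_cong_AE[OF assms(1,1)] assms by simp

text \<open>Since \<open>L2_deriv\<close> selects a representative at each point, derivatives are
  identified only almost everywhere; this allows differentiation to continue with any other choice
  of representatives.\<close>

lemma L2_has_deriv_cong_AE:
  assumes d: "L2_has_deriv P X u g x" and x: "x \<in> X"
    and ae: "\<And>y. y \<in> X \<Longrightarrow> AE s in P. u y s = v y s" and v: "\<And>y. y \<in> X \<Longrightarrow> v y \<in> L2 P"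
  shows "L2_has_deriv P X v g x"
  unfolding L2_has_deriv_def
proof (intro conjI ballI)
  have L: "g \<in> L2 P" "\<And>y. y \<in> X \<Longrightarrow> u y \<in> L2 P" using d by (auto simp: L2_has_deriv_def)
  have mem: "(\<lambda>s. (w y s - w x s) / (y - x) - g s) \<in> L2 P" if "w y \<in> L2 P" "w x \<in> L2 P" for w y
    using L2_diff[OF L2_scale[OF L2_diff[OF that], of "1 / (y - x)"] L(1)] by simp
  have "L2_norm P (\<lambda>s. (u y s - u x s) / (y - x) - g s) = L2_norm P (\<lambda>s. (v y s - v x s) / (y - x) - g s)"
    if y: "y \<in> X" for y
  proof (rule L2_norm_cong_AE)
    show "AE s in P. (u y s - u x s) / (y - x) - g s = (v y s - v x s) / (y - x) - g s"
      using ae[OF y] ae[OF x] by eventually_elim simp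
  qed (use L v x y mem in auto)
  moreover have "((\<lambda>y. L2_norm P (\<lambda>s. (u y s - u x s) / (y - x) - g s)) \<longlongrightarrow> 0) (at x within X)"
    using d by (simp add: L2_has_deriv_def)
  ultimately show "((\<lambda>y. L2_norm P (\<lambda>s. (v y s - v x s) / (y - x) - g s)) \<longlongrightarrow> 0) (at x within X)"
    by (elim Lim_transform_eventually) (simp add: eventually_at_filter)
qed (use d v in \<open>auto simp: L2_has_deriv_def\<close>)

lemma L2_deriv_works:
  assumes "L2_has_deriv P X u g x"
  shows "L2_has_deriv P X u (L2_deriv P X u x) x"
  unfolding L2_deriv_def by (rule someI[of _ g]) (rule assms)

lemma (in finite_measure) bounded_measurable_integrable:
  assumes "f \<in> borel_measurable M" "\<And>s. \<bar>f s :: real\<bar> \<le> C"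
  shows "integrable M f"
  using assms by (intro integrable_const_bound[where B = C] AE_I2) auto

locale gauss_frame = finite_measure P for P :: "real measure" +
  fixes S :: "real set"
  assumes sets_P: "sets P = sets (restrict_space borel S)"
    and nonzero: "emeasure P (space P) > 0"
begin

lemma borel_measurable_P:
  fixes f :: "real \<Rightarrow> real"
  assumes "f \<in> borel_measurable borel"
  shows "f \<in> borel_measurable P"
proof -
  have "f \<in> borel_measurable (restrict_space borel S)"
    using assms by (rule measurable_restrict_space1)
  then show ?thesis by (simp add: measurable_cong_sets[OF sets_P refl])
qed

lemma bounded_square_integrable:
  assumes "f \<in> borel_measurable borel" "\<And>s. \<bar>f s :: real\<bar> \<le> C"
  shows "integrable P (\<lambda>s. f s * f s)" "(\<integral>s. f s * f s \<partial>P) \<le> C\<^sup>2 * measure P (space P)"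
proof -
  have m: "(\<lambda>s. f s * f s) \<in> borel_measurable P"
    using assms(1) by (intro borel_measurable_times borel_measurable_P)
  have b: "f s * f s \<le> C\<^sup>2" for s
    using power_mono[OF assms(2)[of s] abs_ge_zero, of 2] by (simp add: power2_eq_square)
  have "\<bar>f s * f s\<bar> \<le> C\<^sup>2" for s using b[of s] by simp
  from bounded_measurable_integrable[OF m this] show i: "integrable P (\<lambda>s. f s * f s)" .
  have "(\<integral>s. f s * f s \<partial>P) \<le> (\<integral>s. C\<^sup>2 \<partial>P)"
    by (rule integral_mono[OF i _ b]) simp
  then show "(\<integral>s. f s * f s \<partial>P) \<le> C\<^sup>2 * measure P (space P)" by (simp add: mult.commute)
qed

lemma bounded_imp_L2:
  assumes "f \<in> borel_measurable borel" "\<And>s. \<bar>f s :: real\<bar> \<le> C"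
  shows "f \<in> L2 P"
  using bounded_square_integrable(1)[OF assms] borel_measurable_P[OF assms(1)]
  by (simp add: L2_def power2_eq_square)

lemma L2_norm_le_bound:
  assumes "f \<in> borel_measurable borel" "\<And>s. \<bar>f s :: real\<bar> \<le> C"
  shows "L2_norm P f \<le> C * sqrt (measure P (space P))"
proof -
  have "C \<ge> 0" using assms(2)[of 0] by linarith
  have "L2_norm P f \<le> sqrt (C\<^sup>2 * measure P (space P))"
    unfolding L2_norm_def L2_inner_def
    by (intro real_sqrt_le_mono bounded_square_integrable(2) assms)
  then show ?thesis using \<open>C \<ge> 0\<close> by (simp add: real_sqrt_mult)
qed

lemma L2_integrable:
  assumes "p \<in> L2 P"
  shows "integrable P p"
proof -
  have "(\<lambda>_. 1) \<in> L2 P" by (rule bounded_imp_L2[where C = 1]) auto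
  from L2_mult_integrable[OF this assms] show ?thesis by simp
qed

text \<open>These are the successive derivatives of \<open>E 0\<close>, which equals the Gaussian
  mass up to the factor \<open>exp (- x\<^sup>2)\<close>. That factor cancels in the normalized
  atom.\<close>

definition E :: "nat \<Rightarrow> real \<Rightarrow> real" where
  "E j x = (\<integral>s. (2 * s) ^ j * exp (2 * x * s - s\<^sup>2) \<partial>P)"

lemma E_deriv: "(E j has_real_derivative E (Suc j) x) (at x)"
  using bounded_jet_integral_deriv[OF bounded_jet_gauss_kernel[of 1] borel_measurable_P, of "\<lambda>_. 1" j x]
  unfolding E_def[abs_def] mult_1 mult_1_right by simp

lemma E_0_pos: "E 0 x > 0"
proof -
  have i: "integrable P (\<lambda>s. exp (2 * x * s - s\<^sup>2))"
    using bounded_jet_integrable[OF bounded_jet_gauss_kernel[of 1] borel_measurable_P, of "\<lambda>_. 1" 0 x]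
    by simp
  have "E 0 x \<noteq> 0"
  proof
    assume "E 0 x = 0"
    then have "AE s in P. exp (2 * x * s - s\<^sup>2) = 0"
      unfolding E_def by (subst (asm) integral_nonneg_eq_0_iff_AE) (use i in auto)
    then have "AE s in P. False" by simp
    then show False using nonzero by (simp add: AE_iff_measurable[OF sets.top])
  qed
  moreover have "E 0 x \<ge> 0" unfolding E_def by simp
  ultimately show ?thesis by simp
qed

lemma gauss_eq: "gauss x s = exp (- x\<^sup>2) * exp (2 * x * s - s\<^sup>2)"
  by (simp add: gauss_def power2_diff flip: exp_add)

lemma gauss_atom_eq: "gauss_atom P x s = exp (2 * x * s - s\<^sup>2) / E 0 x"
proof -
  have "gauss_mass P x = exp (- x\<^sup>2) * E 0 x"
    by (simp add: gauss_mass_def gauss_eq E_def)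
  then show ?thesis by (simp add: gauss_atom_def gauss_eq)
qed

text \<open>A differential algebra containing all coefficient functions of the derivatives of the
  normalized atoms.\<close>

inductive_set coeffs :: "(real \<Rightarrow> real) set" where
  "E j \<in> coeffs"
| "(\<lambda>x. 1 / E 0 x) \<in> coeffs"
| "(\<lambda>x. c) \<in> coeffs"
| "f \<in> coeffs \<Longrightarrow> g \<in> coeffs \<Longrightarrow> (\<lambda>x. f x + g x) \<in> coeffs"
| "f \<in> coeffs \<Longrightarrow> g \<in> coeffs \<Longrightarrow> (\<lambda>x. f x * g x) \<in> coeffs"

text \<open>The generators have derivatives in the algebra, \<open>1 / E 0\<close> giving
  \<open>- E 1 / (E 0)\<^sup>2\<close>, so every coefficient is smooth without explicit formulas for
  higher derivatives.\<close>

lemma coeffs_deriv: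
  assumes "f \<in> coeffs"
  shows "deriv f \<in> coeffs" "(f has_real_derivative deriv f x) (at x)"
proof -
  have "\<exists>f'\<in>coeffs. \<forall>x. (f has_real_derivative f' x) (at x)" using assms
  proof induction
    case (1 j)
    then show ?case using E_deriv coeffs.intros(1) by blast
  next
    case 2
    have "(\<lambda>x. (- 1) * (E 1 x * ((1 / E 0 x) * (1 / E 0 x)))) \<in> coeffs"
      by (intro coeffs.intros)
    moreover have "((\<lambda>x. 1 / E 0 x) has_real_derivative (- 1) * (E 1 x * ((1 / E 0 x) * (1 / E 0 x)))) (at x)" for x
      using E_0_pos[of x] E_deriv[of 0 x] by (auto intro!: derivative_eq_intros)
    ultimately show ?case
      by (intro bexI[of _ "\<lambda>x. (- 1) * (E 1 x * ((1 / E 0 x) * (1 / E 0 x)))"]) auto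
  next
    case (3 c)
    have "((\<lambda>x. c) has_real_derivative 0) (at x)" for x by simp
    then show ?case using coeffs.intros(3)[of 0] by (intro bexI[of _ "\<lambda>_. 0"]) auto
  next
    case (4 f g)
    then obtain f' g' where *: "f' \<in> coeffs" "g' \<in> coeffs"
      "\<And>x. (f has_real_derivative f' x) (at x)" "\<And>x. (g has_real_derivative g' x) (at x)" by blast
    then have "((\<lambda>x. f x + g x) has_real_derivative f' x + g' x) (at x)" for x
      by (intro DERIV_add)
    then show ?case using coeffs.intros(4)[OF *(1,2)] by (intro bexI[of _ "\<lambda>x. f' x + g' x"]) auto
  next
    case (5 f g)
    then obtain f' g' where *: "f' \<in> coeffs" "g' \<in> coeffs"
      "\<And>x. (f has_real_derivative f' x) (at x)" "\<And>x. (g has_real_derivative g' x) (at x)" by blast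
    then have d: "((\<lambda>x. f x * g x) has_real_derivative f' x * g x + g' x * f x) (at x)" for x
      by (intro DERIV_mult)
    have "(\<lambda>x. f' x * g x + g' x * f x) \<in> coeffs" by (intro coeffs.intros * 5)
    with d show ?case by (intro bexI[of _ "\<lambda>x. f' x * g x + g' x * f x"]) auto
  qed
  then obtain f' where f': "f' \<in> coeffs" "\<And>x. (f has_real_derivative f' x) (at x)" by blast
  then have "deriv f = f'" by (auto intro: DERIV_imp_deriv)
  with f' show "deriv f \<in> coeffs" "(f has_real_derivative deriv f x) (at x)" by auto
qed

text \<open>Coefficient of \<open>s ^ j\<close> in the polynomial factor of the \<open>k\<close>-th
  derivative of the atom. The recursion is the product rule: the exponential contributes a factor
  \<open>2 * s\<close>, which shifts the index by one.\<close>

primrec acoef :: "nat \<Rightarrow> nat \<Rightarrow> real \<Rightarrow> real" where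
  "acoef 0 = (\<lambda>j x. if j = 0 then 1 / E 0 x else 0)"
| "acoef (Suc k) = (\<lambda>j x. deriv (acoef k j) x + (if j = 0 then 0 else 2 * acoef k (j - 1) x))"

lemma acoef_in_coeffs: "acoef k j \<in> coeffs"
proof (induction k arbitrary: j)
  case 0
  then show ?case using coeffs.intros(2) coeffs.intros(3)[of 0] by (cases j) auto
next
  case (Suc k)
  have "(\<lambda>x. deriv (acoef k j) x + (2 * acoef k (j - 1) x)) \<in> coeffs"
    by (intro coeffs.intros coeffs_deriv Suc.IH)
  moreover have "(\<lambda>x. deriv (acoef k j) x) \<in> coeffs" using coeffs_deriv Suc.IH by simp
  ultimately show ?case by (cases j) simp_all
qed

lemma acoef_above: "k < j \<Longrightarrow> acoef k j = (\<lambda>_. 0)"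
  by (induction k arbitrary: j) auto

lemma acoef_lead: "acoef k k x = 2 ^ k / E 0 x"
  by (induction k) (auto simp: acoef_above)

text \<open>The pointwise derivatives of the atom in its parameter. They are concrete
  representatives to which the chosen ones in \<open>L2_nth_deriv\<close> are compared.\<close>

definition atom_jet :: "nat \<Rightarrow> real \<Rightarrow> real \<Rightarrow> real" where
  "atom_jet k x s = (\<Sum>j\<le>k. acoef k j x * s ^ j) * exp (2 * x * s - s\<^sup>2)"

lemma atom_jet_0: "atom_jet 0 = gauss_atom P"
  by (intro ext) (simp add: atom_jet_def gauss_atom_eq)

text \<open>The coefficients are continuous, hence bounded on \<open>[-R, R]\<close>, and the powers
  of \<open>s\<close> are controlled by the Gaussian kernel bound.\<close>

lemma bounded_jet_atom_jet: "bounded_jet atom_jet"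
  unfolding bounded_jet_def
proof (intro conjI allI)
  fix k :: nat and x s R :: real
  have shift: "(\<Sum>j\<le>Suc k. (if j = 0 then 0 else 2 * acoef k (j - 1) x) * s ^ j) =
      2 * s * (\<Sum>j\<le>k. acoef k j x * s ^ j)"
    by (subst sum.atMost_Suc_shift) (simp add: sum_distrib_left mult_ac)
  have low: "(\<Sum>j\<le>Suc k. deriv (acoef k j) x * s ^ j) = (\<Sum>j\<le>k. deriv (acoef k j) x * s ^ j)"
    by (simp add: acoef_above)
  have "atom_jet (Suc k) x s = ((\<Sum>j\<le>k. deriv (acoef k j) x * s ^ j) +
      2 * s * (\<Sum>j\<le>k. acoef k j x * s ^ j)) * exp (2 * x * s - s\<^sup>2)"
    unfolding atom_jet_def shift[symmetric] low[symmetric] by (simp only: acoef.simps(2) distrib_right sum.distrib)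
  moreover have "a * e + e * (2 * s) * b = (a + 2 * s * b) * e" for a b e :: real
    by (simp add: algebra_simps)
  ultimately have jet_Suc: "(\<Sum>j\<le>k. deriv (acoef k j) x * s ^ j) * exp (2 * x * s - s\<^sup>2) +
      exp (2 * x * s - s\<^sup>2) * (2 * s) * (\<Sum>j\<le>k. acoef k j x * s ^ j) = atom_jet (Suc k) x s"
    by (simp only:)
  have "((\<lambda>y. \<Sum>j\<le>k. acoef k j y * s ^ j) has_real_derivative (\<Sum>j\<le>k. deriv (acoef k j) x * s ^ j)) (at x)"
    by (intro DERIV_sum DERIV_cmult_right coeffs_deriv acoef_in_coeffs)
  moreover have "((\<lambda>y. exp (2 * y * s - s\<^sup>2)) has_real_derivative exp (2 * x * s - s\<^sup>2) * (2 * s)) (at x)"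
    by (auto intro!: derivative_eq_intros)
  ultimately show "((\<lambda>y. atom_jet k y s) has_real_derivative atom_jet (Suc k) x s) (at x)"
    unfolding jet_Suc[symmetric] unfolding atom_jet_def by (rule DERIV_mult)
  show "atom_jet k x \<in> borel_measurable borel"
    unfolding atom_jet_def[abs_def] by (intro borel_measurable_continuous_onI continuous_intros)
  have "\<exists>B. \<forall>x. \<bar>x\<bar> \<le> R \<longrightarrow> \<bar>acoef k j x\<bar> \<le> B" for j
  proof -
    have "continuous_on {-R..R} (acoef k j)"
      by (intro continuous_at_imp_continuous_on ballI DERIV_isCont[OF coeffs_deriv(2)] acoef_in_coeffs)
    then have "bounded (acoef k j ` {-R..R})" by (intro compact_imp_bounded compact_continuous_image) auto
    then show ?thesis by (force simp: bounded_iff abs_le_iff)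
  qed
  then have "\<forall>j. \<exists>B. \<forall>x. \<bar>x\<bar> \<le> R \<longrightarrow> \<bar>acoef k j x\<bar> \<le> B" by blast
  from choice[OF this] obtain B where B: "\<And>j x. \<bar>x\<bar> \<le> R \<Longrightarrow> \<bar>acoef k j x\<bar> \<le> B j" by blast
  have "\<bar>atom_jet k x s\<bar> \<le> (\<Sum>j\<le>k. B j * (fact j * exp ((R + 1)\<^sup>2)))" if x: "\<bar>x\<bar> \<le> R" for x s
  proof -
    have "\<bar>atom_jet k x s\<bar> \<le> (\<Sum>j\<le>k. \<bar>acoef k j x * (s ^ j * exp (2 * x * s - s\<^sup>2))\<bar>)"
      unfolding atom_jet_def sum_distrib_right mult.assoc by (rule sum_abs)
    also have "\<dots> \<le> (\<Sum>j\<le>k. B j * (fact j * exp ((R + 1)\<^sup>2)))"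
    proof (rule sum_mono)
      fix j
      have "\<bar>s ^ j * exp (2 * x * s - s\<^sup>2)\<bar> \<le> \<bar>(2 * s) ^ j * exp (2 * x * s - s\<^sup>2)\<bar>"
        unfolding abs_mult power_abs by (intro mult_right_mono power_mono) auto
      also have "\<dots> \<le> fact j * exp ((R + 1)\<^sup>2)"
        using gauss_kernel_bound[of 1 x R s j] x by simp
      finally show "\<bar>acoef k j x * (s ^ j * exp (2 * x * s - s\<^sup>2))\<bar> \<le> B j * (fact j * exp ((R + 1)\<^sup>2))"
        unfolding abs_mult[of "acoef k j x"] using B[OF x, of j] by (intro mult_mono) auto
    qed
    finally show ?thesis .
  qed
  then show "\<exists>C. \<forall>x s. \<bar>x\<bar> \<le> R \<longrightarrow> \<bar>atom_jet k x s\<bar> \<le> C" by blast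
qed

lemma atom_jet_bounded: "\<exists>C. \<forall>x s. \<bar>x\<bar> \<le> R \<longrightarrow> \<bar>atom_jet k x s\<bar> \<le> C"
  and atom_jet_measurable: "atom_jet k x \<in> borel_measurable borel"
  using bounded_jet_atom_jet unfolding bounded_jet_def by blast+

lemma atom_jet_L2: "atom_jet k x \<in> L2 P"
proof -
  obtain C where "\<And>s. \<bar>atom_jet k x s\<bar> \<le> C" using atom_jet_bounded[of "\<bar>x\<bar>" k] by auto
  from bounded_imp_L2[OF atom_jet_measurable this] show ?thesis .
qed

section \<open>Regularity of the atoms in \<open>L2\<close>\<close>

lemma atom_jet_L2_has_deriv: "L2_has_deriv P X (atom_jet k) (atom_jet (Suc k) x) x"
  unfolding L2_has_deriv_def
proof (intro conjI ballI atom_jet_L2)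
  obtain C where C: "C \<ge> 0" "\<And>y s. \<bar>y\<bar> \<le> \<bar>x\<bar> + 1 \<Longrightarrow>
      \<bar>atom_jet k y s - atom_jet k x s - (y - x) * atom_jet (Suc k) x s\<bar> \<le> C * (y - x)\<^sup>2"
    using bounded_jet_remainder[OF bounded_jet_atom_jet, of "\<bar>x\<bar> + 1" k] by auto
  have "norm (L2_norm P (\<lambda>s. (atom_jet k y s - atom_jet k x s) / (y - x) - atom_jet (Suc k) x s))
      \<le> C * \<bar>y - x\<bar> * sqrt (measure P (space P))" if y: "y \<noteq> x" "dist y x < 1" for y
  proof -
    have "\<bar>(atom_jet k y s - atom_jet k x s) / (y - x) - atom_jet (Suc k) x s\<bar> \<le> C * \<bar>y - x\<bar>" for s
    proof -
      have "\<bar>(atom_jet k y s - atom_jet k x s) / (y - x) - atom_jet (Suc k) x s\<bar> * \<bar>y - x\<bar> =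
          \<bar>atom_jet k y s - atom_jet k x s - (y - x) * atom_jet (Suc k) x s\<bar>"
        using y(1) by (simp add: field_simps flip: abs_mult)
      also have "\<dots> \<le> C * (y - x)\<^sup>2" using y by (intro C) (simp add: dist_real_def)
      also have "\<dots> = (C * \<bar>y - x\<bar>) * \<bar>y - x\<bar>" by (simp add: power2_eq_square)
      finally show ?thesis using y(1) by simp
    qed
    then have "L2_norm P (\<lambda>s. (atom_jet k y s - atom_jet k x s) / (y - x) - atom_jet (Suc k) x s)
      \<le> C * \<bar>y - x\<bar> * sqrt (measure P (space P))"
      using atom_jet_measurable by (intro L2_norm_le_bound) (auto intro!: borel_measurable_diff borel_measurable_divide)
    then show ?thesis by (simp add: L2_norm_def L2_inner_self_nonneg)
  qed
  then have ev: "\<forall>\<^sub>F y in at x within X. norm (L2_norm P (\<lambda>s. (atom_jet k y s - atom_jet k x s) / (y - x) - atom_jet (Suc k) x s))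
      \<le> C * \<bar>y - x\<bar> * sqrt (measure P (space P))"
    unfolding eventually_at by (intro exI[of _ 1]) auto
  have "((\<lambda>y. C * \<bar>y - x\<bar> * sqrt (measure P (space P))) \<longlongrightarrow> C * \<bar>x - x\<bar> * sqrt (measure P (space P))) (at x within X)"
    by (intro tendsto_intros)
  then show "((\<lambda>y. L2_norm P (\<lambda>s. (atom_jet k y s - atom_jet k x s) / (y - x) - atom_jet (Suc k) x s)) \<longlongrightarrow> 0)
      (at x within X)"
    by (intro Lim_null_comparison[OF ev]) simp
qed

lemma atom_jet_L2_continuous: "((\<lambda>y. L2_norm P (\<lambda>s. atom_jet k y s - atom_jet k x s)) \<longlongrightarrow> 0) (at x within X)"
proof -
  obtain C where C: "C \<ge> 0" "\<And>y s. \<bar>y\<bar> \<le> \<bar>x\<bar> + 1 \<Longrightarrow>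
      \<bar>atom_jet k y s - atom_jet k x s - (y - x) * atom_jet (Suc k) x s\<bar> \<le> C * (y - x)\<^sup>2"
    using bounded_jet_remainder[OF bounded_jet_atom_jet, of "\<bar>x\<bar> + 1" k] by auto
  obtain D where D: "\<And>s. \<bar>atom_jet (Suc k) x s\<bar> \<le> D" using atom_jet_bounded[of "\<bar>x\<bar>" "Suc k"] by auto
  let ?B = "\<lambda>y. (C * (y - x)\<^sup>2 + \<bar>y - x\<bar> * D) * sqrt (measure P (space P))"
  have "norm (L2_norm P (\<lambda>s. atom_jet k y s - atom_jet k x s)) \<le> ?B y" if y: "dist y x < 1" for y
  proof -
    have "\<bar>atom_jet k y s - atom_jet k x s\<bar> \<le> C * (y - x)\<^sup>2 + \<bar>y - x\<bar> * D" for s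
    proof -
      have "\<bar>atom_jet k y s - atom_jet k x s - (y - x) * atom_jet (Suc k) x s\<bar> \<le> C * (y - x)\<^sup>2"
        using y by (intro C) (simp add: dist_real_def)
      moreover have "\<bar>(y - x) * atom_jet (Suc k) x s\<bar> \<le> \<bar>y - x\<bar> * D"
        unfolding abs_mult by (intro mult_left_mono D) simp
      ultimately show ?thesis by linarith
    qed
    then have "L2_norm P (\<lambda>s. atom_jet k y s - atom_jet k x s) \<le> ?B y"
      using atom_jet_measurable by (intro L2_norm_le_bound borel_measurable_diff)
    then show ?thesis by (simp add: L2_norm_def L2_inner_self_nonneg)
  qed
  then have ev: "\<forall>\<^sub>F y in at x within X. norm (L2_norm P (\<lambda>s. atom_jet k y s - atom_jet k x s)) \<le> ?B y"
    unfolding eventually_at by (intro exI[of _ 1]) auto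
  have "(?B \<longlongrightarrow> ?B x) (at x within X)" by (intro tendsto_intros)
  then show ?thesis by (intro Lim_null_comparison[OF ev]) simp
qed

text \<open>The three claims are proved by one induction: existence of a derivative makes the next
  choice meaningful, uniqueness identifies it with \<open>atom_jet\<close> almost everywhere, and
  the congruence lemma yields existence at the next order.\<close>

lemma L2_nth_deriv_gauss_atom:
  assumes X: "\<And>x. x \<in> X \<Longrightarrow> at x within X \<noteq> bot" and x: "x \<in> X"
  shows "L2_nth_deriv P X (gauss_atom P) k x \<in> L2 P"
    and "AE s in P. L2_nth_deriv P X (gauss_atom P) k x s = atom_jet k x s"
    and "L2_has_deriv P X (L2_nth_deriv P X (gauss_atom P) k) (atom_jet (Suc k) x) x"
proof -
  have "\<forall>x\<in>X. L2_nth_deriv P X (gauss_atom P) k x \<in> L2 P \<and>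
      (AE s in P. L2_nth_deriv P X (gauss_atom P) k x s = atom_jet k x s) \<and>
      L2_has_deriv P X (L2_nth_deriv P X (gauss_atom P) k) (atom_jet (Suc k) x) x"
  proof (induction k)
    case 0
    show ?case using atom_jet_L2[of 0] atom_jet_L2_has_deriv[of X 0] by (simp add: atom_jet_0)
  next
    case (Suc k)
    let ?u = "L2_nth_deriv P X (gauss_atom P)"
    have d: "L2_has_deriv P X (?u k) (?u (Suc k) x) x" if "x \<in> X" for x
      using L2_deriv_works[of P X "?u k"] Suc.IH that by auto
    have L: "?u (Suc k) x \<in> L2 P" if "x \<in> X" for x
      using d[OF that] unfolding L2_has_deriv_def by blast
    have ae: "AE s in P. atom_jet (Suc k) x s = ?u (Suc k) x s" if "x \<in> X" for x
      using L2_has_deriv_unique[OF _ d[OF that] that X[OF that]] Suc.IH that by blast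
    have "L2_has_deriv P X (?u (Suc k)) (atom_jet (Suc (Suc k)) x) x" if "x \<in> X" for x
      by (rule L2_has_deriv_cong_AE[OF atom_jet_L2_has_deriv that ae L])
    moreover have "AE s in P. ?u (Suc k) x s = atom_jet (Suc k) x s" if "x \<in> X" for x
      using ae[OF that] by eventually_elim simp
    ultimately show ?case using L by blast
  qed
  with x show "L2_nth_deriv P X (gauss_atom P) k x \<in> L2 P"
    "AE s in P. L2_nth_deriv P X (gauss_atom P) k x s = atom_jet k x s"
    "L2_has_deriv P X (L2_nth_deriv P X (gauss_atom P) k) (atom_jet (Suc k) x) x" by auto
qed

lemma L2_Ck_gauss_atom:
  assumes X: "\<And>x. x \<in> X \<Longrightarrow> at x within X \<noteq> bot"
  shows "L2_Ck P X k (gauss_atom P)"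
  unfolding L2_Ck_def L2_continuous_on_def
proof (intro conjI ballI allI impI)
  have n: "L2_nth_deriv P X (gauss_atom P) i x \<in> L2 P"
    "AE s in P. L2_nth_deriv P X (gauss_atom P) i x s = atom_jet i x s"
    "L2_has_deriv P X (L2_nth_deriv P X (gauss_atom P) i) (atom_jet (Suc i) x) x" if "x \<in> X" for i x
    by (rule L2_nth_deriv_gauss_atom, use X that in auto)+
  show "\<exists>g. L2_has_deriv P X (L2_nth_deriv P X (gauss_atom P) i) g x" if "x \<in> X" for i x
    using n(3)[OF that] by blast
  show "L2_nth_deriv P X (gauss_atom P) k x \<in> L2 P" if "x \<in> X" for x
    using n(1)[OF that] by blast
  fix x assume x: "x \<in> X"
  have "L2_norm P (\<lambda>s. atom_jet k y s - atom_jet k x s) =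
      L2_norm P (\<lambda>s. L2_nth_deriv P X (gauss_atom P) k y s - L2_nth_deriv P X (gauss_atom P) k x s)"
    if y: "y \<in> X" for y
  proof (rule L2_norm_cong_AE)
    show "AE s in P. atom_jet k y s - atom_jet k x s =
      L2_nth_deriv P X (gauss_atom P) k y s - L2_nth_deriv P X (gauss_atom P) k x s"
      using n(2)[OF x, of k] n(2)[OF y, of k] by eventually_elim simp
  qed (auto intro!: L2_diff atom_jet_L2 n(1) x y)
  then show "((\<lambda>y. L2_norm P (\<lambda>s. L2_nth_deriv P X (gauss_atom P) k y s -
      L2_nth_deriv P X (gauss_atom P) k x s)) \<longlongrightarrow> 0) (at x within X)"
    by (intro Lim_transform_eventually[OF atom_jet_L2_continuous[of k x X]]) (simp add: eventually_at_filter)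
qed

lemma L2_inner_atom_jet_deriv:
  assumes "p \<in> L2 P"
  shows "((\<lambda>y. L2_inner P (atom_jet k y) p) has_real_derivative L2_inner P (atom_jet (Suc k) x) p) (at x)"
  unfolding L2_inner_def
  by (rule bounded_jet_integral_deriv[where u = atom_jet and M = P and p = p and k = k and x = x,
        OF bounded_jet_atom_jet borel_measurable_P L2_integrable[OF assms]])

text \<open>All pointwise constraints on a certificate thereby become inner products with jets of
  the atom, the form required for projection.\<close>

lemma nth_deriv_Phi_adj:
  assumes "p \<in> L2 P"
  shows "(deriv ^^ k) (Phi_adj P (gauss_atom P) p) = (\<lambda>x. L2_inner P (atom_jet k x) p)"
proof (induction k)
  case 0
  then show ?case by (simp add: Phi_adj_def[abs_def] atom_jet_0)
next
  case (Suc k)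
  have "deriv (\<lambda>x. L2_inner P (atom_jet k x) p) = (\<lambda>x. L2_inner P (atom_jet (Suc k) x) p)"
    by (intro ext DERIV_imp_deriv L2_inner_atom_jet_deriv assms)
  then show ?case by (simp add: Suc)
qed

lemma const_L2: "(\<lambda>_. c) \<in> L2 P"
  by (rule bounded_imp_L2[where C = "\<bar>c\<bar>"]) auto

lemma L2_inner_atom_jet_1: "L2_inner P (atom_jet k x) (\<lambda>_. 1) = (if k = 0 then 1 else 0)"
proof -
  have "L2_inner P (atom_jet 0 y) (\<lambda>_. 1) = 1" for y
    using E_0_pos[of y] by (simp add: atom_jet_0 gauss_atom_eq L2_inner_def E_def)
  then have "Phi_adj P (gauss_atom P) (\<lambda>_. 1) = (\<lambda>_. 1)" by (simp add: Phi_adj_def[abs_def] atom_jet_0)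
  moreover have "(deriv ^^ k) (\<lambda>_. 1 :: real) = (\<lambda>_. if k = 0 then 1 else 0)"
    by (induction k) auto
  ultimately show ?thesis using fun_cong[OF nth_deriv_Phi_adj[OF const_L2[of 1], of k], of x] by simp
qed

text \<open>On compact \<open>X\<close> the condition of \<open>C0\<close> reduces to continuity,
  with \<open>X\<close> itself as the compact set, and the local bounds on the jets become
  global.\<close>

lemma class_K_gauss_atom:
  assumes X: "\<And>x. x \<in> X \<Longrightarrow> at x within X \<noteq> bot" and cpt: "compact X"
  shows "class_K P X k (gauss_atom P)"
  unfolding class_K_def
proof (intro conjI ballI allI impI)
  show "L2_Ck P X k (gauss_atom P)" by (rule L2_Ck_gauss_atom) (rule X)
  show "(\<lambda>x. L2_inner P p (gauss_atom P x)) \<in> C0 X" if "p \<in> L2 P" for p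
  proof -
    have "continuous_on X (\<lambda>x. L2_inner P p (gauss_atom P x))"
      unfolding L2_inner_commute[of P p] atom_jet_0[symmetric]
      by (intro continuous_at_imp_continuous_on ballI DERIV_isCont[OF L2_inner_atom_jet_deriv[OF that]])
    with cpt show ?thesis by (auto simp: C0_def)
  qed
  fix i
  obtain R where R: "\<And>x. x \<in> X \<Longrightarrow> \<bar>x\<bar> \<le> R" using compact_imp_bounded[OF cpt] by (auto simp: bounded_iff)
  obtain C where C: "\<And>x s. \<bar>x\<bar> \<le> R \<Longrightarrow> \<bar>atom_jet i x s\<bar> \<le> C" using atom_jet_bounded[of R i] by blast
  have "L2_norm P (L2_nth_deriv P X (gauss_atom P) i x) \<le> C * sqrt (measure P (space P))" if x: "x \<in> X" for x
  proof -
    have "L2_norm P (L2_nth_deriv P X (gauss_atom P) i x) = L2_norm P (atom_jet i x)"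
      by (intro L2_norm_cong_AE atom_jet_L2 L2_nth_deriv_gauss_atom X x)
    then show ?thesis using L2_norm_le_bound[OF atom_jet_measurable C[OF R[OF x]]] by simp
  qed
  then show "bdd_above ((\<lambda>x. L2_norm P (L2_nth_deriv P X (gauss_atom P) i x)) ` X)"
    by (auto simp: bdd_above_def)
qed

end

section \<open>Quasi-polynomials and the Gaussian\<close>

text \<open>The effect of \<open>D - c\<close> on the polynomial factor of
  \<open>poly q s * exp (d * s)\<close>.\<close>

definition qpoly_step :: "real \<Rightarrow> real \<Rightarrow> real poly \<Rightarrow> real poly" where
  "qpoly_step d c q = pderiv q + smult (d - c) q"

lemma diff_op_qpoly:
  "diff_op cs (\<lambda>s. poly p s * exp (d * s)) (\<lambda>s. poly (fold (qpoly_step d) cs p) s * exp (d * s))"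
proof (induction cs arbitrary: p)
  case (Cons c cs)
  have "((\<lambda>s. poly p s * exp (d * s)) has_real_derivative
      c * (poly p s * exp (d * s)) + poly (qpoly_step d c p) s * exp (d * s)) (at s)" for s
    by (auto intro!: derivative_eq_intros simp: qpoly_step_def algebra_simps)
  with Cons.IH[of "qpoly_step d c p"] show ?case
    by (auto intro!: exI[of _ "\<lambda>s. poly (qpoly_step d c p) s * exp (d * s)"])
qed simp

text \<open>A factor with \<open>c = d\<close> differentiates the polynomial, and any other factor
  scales the tracked coefficient by \<open>d - c\<close>. The result vanishes when the degree is
  below the multiplicity of \<open>d\<close>.\<close>

lemma fold_qpoly_step:
  assumes "degree p \<le> count_list cs d"
  shows "fold (qpoly_step d) cs p = [:coeff p (count_list cs d) * fact (count_list cs d) *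
    prod_list (map (\<lambda>c. d - c) (filter (\<lambda>c. c \<noteq> d) cs)):]"
  using assms
proof (induction cs arbitrary: p)
  case Nil
  then show ?case using degree_eq_zeroE[of p] by fastforce
next
  case (Cons c cs)
  let ?m = "count_list cs d"
  show ?case
  proof (cases "c = d")
    case True
    have "degree (pderiv p) \<le> ?m" using Cons.prems True by (simp add: degree_pderiv)
    from Cons.IH[OF this] True show ?thesis by (simp add: qpoly_step_def coeff_pderiv mult_ac)
  next
    case False
    have deg: "degree p \<le> ?m" using Cons.prems False by simp
    have "degree (qpoly_step d c p) \<le> ?m"
      unfolding qpoly_step_def using deg by (intro degree_add_le) (auto simp: degree_pderiv)
    moreover have "coeff (qpoly_step d c p) ?m = (d - c) * coeff p ?m"
      using deg by (simp add: qpoly_step_def coeff_pderiv coeff_eq_0)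
    ultimately show ?thesis using Cons.IH[of "qpoly_step d c p"] False by (simp add: mult_ac)
  qed
qed

section \<open>Node multiplicities and signs of node products\<close>

lemma count_list_map_upt:
  "count_list (map f [0..<k]) c = card {i. i < k \<and> f i = c}"
proof (induction k)
  case (Suc k)
  have "{i. i < Suc k \<and> f i = c} = (if f k = c then insert k {i. i < k \<and> f i = c} else {i. i < k \<and> f i = c})"
    by (auto simp: less_Suc_eq)
  with Suc show ?case by simp
qed simp

lemma prod_list_filter_map_upt:
  "prod_list (map g (filter Q (map f [0..<k]))) = (\<Prod>i | i < k \<and> Q (f i). g (f i) :: real)"
proof (induction k)
  case (Suc k)
  have "{i. i < Suc k \<and> Q (f i)} = (if Q (f k) then insert k {i. i < k \<and> Q (f i)} else {i. i < k \<and> Q (f i)})"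
    by (auto simp: less_Suc_eq)
  with Suc show ?case by simp
qed simp

text \<open>Grouping the factors by the value of \<open>\<xi>\<close> writes the product as one of
  even powers of nonzero numbers.\<close>

lemma prod_even_fibers_pos:
  fixes \<xi> :: "nat \<Rightarrow> real"
  assumes even: "\<And>t. even (card {i. i < n \<and> \<xi> i = t})"
  shows "(\<Prod>i | i < n \<and> \<xi> i \<noteq> y. y - \<xi> i) > 0"
proof -
  define A where "A = {i. i < n \<and> \<xi> i \<noteq> y}"
  have "(\<Prod>i\<in>A. y - \<xi> i) = (\<Prod>v\<in>\<xi> ` A. \<Prod>i | i \<in> A \<and> \<xi> i = v. y - \<xi> i)"
    by (intro prod.image_gen) (simp add: A_def)
  also have "\<dots> > 0"
  proof (rule prod_pos)
    fix v assume v: "v \<in> \<xi> ` A"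
    then have ne: "v \<noteq> y" and fib: "{i. i \<in> A \<and> \<xi> i = v} = {i. i < n \<and> \<xi> i = v}" by (auto simp: A_def)
    have "(\<Prod>i | i \<in> A \<and> \<xi> i = v. y - \<xi> i) = (\<Prod>i | i \<in> A \<and> \<xi> i = v. y - v)"
      by (intro prod.cong) auto
    also have "\<dots> = (y - v) ^ card {i. i < n \<and> \<xi> i = v}" unfolding fib by simp
    also have "\<dots> > 0" using even[of v] ne by (simp add: zero_less_power_eq)
    finally show "(\<Prod>i | i \<in> A \<and> \<xi> i = v. y - \<xi> i) > 0" .
  qed
  finally show ?thesis by (simp add: A_def)
qed

lemma prod_even_fibers_nonneg:
  fixes \<xi> :: "nat \<Rightarrow> real"
  assumes even: "\<And>t. even (card {i. i < n \<and> \<xi> i = t})"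
  shows "(\<Prod>i<n. t - \<xi> i) \<ge> 0"
proof (cases "\<exists>i<n. \<xi> i = t")
  case True
  then have "(\<Prod>i<n. t - \<xi> i) = 0" by force
  then show ?thesis by (simp only: order_refl)
next
  case False
  then have "{i. i < n \<and> \<xi> i \<noteq> t} = {..<n}" by auto
  with prod_even_fibers_pos[OF even, of t] show ?thesis by simp
qed

text \<open>Up to a constant this integrates \<open>poly p (2 * t) * exp (2 * s * t)\<close> against
  \<open>exp (- t\<^sup>2)\<close>. Half of the Gaussian is placed in the probability measure, and
  the other half keeps the integrand bounded.\<close>

definition gauss_poly_integral :: "real poly \<Rightarrow> real \<Rightarrow> real" where
  "gauss_poly_integral p s =
     (\<integral>t. poly p (2 * t) * exp (2 * s * t - (1/2) * t\<^sup>2) \<partial>density lborel std_normal_density)"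

text \<open>Expanding \<open>p\<close> into monomials reduces both claims to the Gaussian kernel. A
  derivative in \<open>s\<close> brings down \<open>2 * t\<close>, that is, it multiplies
  \<open>p\<close> by the variable, which is \<open>pCons 0 p\<close>.\<close>

lemma
  shows integrable_gauss_poly:
    "integrable (density lborel std_normal_density) (\<lambda>t. poly p (2 * t) * exp (2 * s * t - (1/2) * t\<^sup>2))"
      (is ?int)
    and gauss_poly_integral_deriv:
    "(gauss_poly_integral p has_real_derivative gauss_poly_integral (pCons 0 p) s) (at s)" (is ?deriv)
proof -
  let ?N = "density lborel std_normal_density"
  interpret N: prob_space ?N by (rule prob_space_normal_density) simp
  define u :: "nat \<Rightarrow> real \<Rightarrow> real \<Rightarrow> real" where
    "u j s t = (2 * t) ^ j * exp (2 * s * t - (1/2) * t\<^sup>2)" for j s t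
  have u: "bounded_jet u" unfolding u_def by (rule bounded_jet_gauss_kernel) simp
  have meas: "f \<in> borel_measurable ?N" if "f \<in> borel_measurable borel" for f :: "real \<Rightarrow> real"
    using that by simp
  have int: "integrable ?N (u j s)" for j s
    using bounded_jet_integrable[where u = u and M = ?N and p = "\<lambda>_. 1", OF u meas] by simp
  have du: "((\<lambda>s. integral\<^sup>L ?N (u j s)) has_real_derivative integral\<^sup>L ?N (u (Suc j) s)) (at s)" for j s
    using bounded_jet_integral_deriv[where u = u and M = ?N and p = "\<lambda>_. 1", OF u meas] by simp
  have eq: "(\<lambda>t. poly q (2 * t) * exp (2 * s * t - (1/2) * t\<^sup>2)) = (\<lambda>t. \<Sum>j\<le>degree q. coeff q j * u j s t)" for q s
    by (simp add: poly_altdef u_def sum_distrib_right mult.assoc)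
  show ?int unfolding eq by (intro Bochner_Integration.integrable_sum integrable_mult_right int)
  have I: "gauss_poly_integral q = (\<lambda>s. \<Sum>j\<le>degree q. coeff q j * integral\<^sup>L ?N (u j s))" for q
  proof
    fix s show "gauss_poly_integral q s = (\<Sum>j\<le>degree q. coeff q j * integral\<^sup>L ?N (u j s))"
      unfolding gauss_poly_integral_def eq
      by (subst Bochner_Integration.integral_sum) (simp_all add: int)
  qed
  have "(\<Sum>j\<le>degree (pCons 0 p). coeff (pCons 0 p) j * integral\<^sup>L ?N (u j s)) =
      (\<Sum>j\<le>degree p. coeff p j * integral\<^sup>L ?N (u (Suc j) s))"
  proof (cases "p = 0")
    case False
    then have "degree (pCons 0 p) = Suc (degree p)" by simp
    then show ?thesis by (simp add: sum.atMost_Suc_shift del: sum.atMost_Suc degree_pCons_eq_if)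
  qed simp
  moreover have "((\<lambda>s. \<Sum>j\<le>degree p. coeff p j * integral\<^sup>L ?N (u j s)) has_real_derivative
      (\<Sum>j\<le>degree p. coeff p j * integral\<^sup>L ?N (u (Suc j) s))) (at s)"
    by (intro DERIV_sum DERIV_cmult du)
  ultimately show ?deriv unfolding I by simp
qed

text \<open>Completing the square gives a multiple of the normal density with mean \<open>s\<close>
  and standard deviation \<open>1 / sqrt 2\<close>, whose integral is 1.\<close>

lemma gauss_poly_integral_1: "sqrt 2 * gauss_poly_integral 1 s = exp (s\<^sup>2)"
proof -
  have "sqrt (2 * pi) = sqrt 2 * sqrt pi" by (simp add: real_sqrt_mult)
  then have eq: "std_normal_density t * exp (2 * s * t - (1/2) * t\<^sup>2) =
      exp (s\<^sup>2) / sqrt 2 * normal_density s (1 / sqrt 2) t" for t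
    unfolding std_normal_density_def normal_density_def
    by (simp add: power_divide field_simps power2_eq_square flip: exp_add)
  have "gauss_poly_integral 1 s = (\<integral>t. std_normal_density t * exp (2 * s * t - (1/2) * t\<^sup>2) \<partial>lborel)"
    unfolding gauss_poly_integral_def by (subst integral_density) auto
  also have "\<dots> = exp (s\<^sup>2) / sqrt 2" unfolding eq by simp
  finally show ?thesis by simp
qed

text \<open>A nonzero polynomial has finitely many roots, which form a Lebesgue null set, so the
  nonnegative integrand cannot vanish almost everywhere.\<close>

lemma gauss_poly_integral_pos:
  assumes "p \<noteq> 0" "\<And>t. poly p t \<ge> 0"
  shows "gauss_poly_integral p s > 0"
proof -
  let ?N = "density lborel std_normal_density"
  let ?f = "\<lambda>t. poly p (2 * t) * exp (2 * s * t - (1/2) * t\<^sup>2)"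
  have nonneg: "gauss_poly_integral p s \<ge> 0"
    unfolding gauss_poly_integral_def using assms by (intro integral_nonneg_AE AE_I2) simp
  have "gauss_poly_integral p s \<noteq> 0"
  proof
    assume "gauss_poly_integral p s = 0"
    then have "AE t in ?N. ?f t = 0"
      unfolding gauss_poly_integral_def using integrable_gauss_poly assms(2)
      by (subst (asm) integral_nonneg_eq_0_iff_AE) auto
    then have "AE t in lborel. poly p (2 * t) = 0"
      by (subst (asm) AE_density) (auto simp: normal_density_pos)
    moreover have "finite ((\<lambda>t. t / 2) ` {t. poly p t = 0})" using poly_roots_finite[OF assms(1)] by simp
    then have "AE t in lborel. t \<notin> (\<lambda>t. t / 2) ` {t. poly p t = 0}"
      by (intro AE_not_in finite_imp_null_set_lborel)
    then have "AE t in lborel. poly p (2 * t) \<noteq> 0"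
      by (rule AE_mp) (auto intro!: AE_I2 image_eqI[of _ _ "2 * t" for t])
    ultimately have "AE t in lborel. t \<in> ({} :: real set)" by eventually_elim simp
    then show False by (simp add: eventually_False ae_filter_eq_bot_iff)
  qed
  with nonneg show ?thesis by simp
qed

text \<open>The Laplace transform \<open>exp (s\<^sup>2) = c * (\<integral>t. exp (2 s t - t\<^sup>2))\<close> turns the operator into
  multiplication by a polynomial in \<open>t\<close>.\<close>

lemma diff_op_exp_square:
  assumes "\<And>t. 0 \<le> prod_list (map (\<lambda>c. t - c) cs)"
  shows "\<exists>\<rho>. (\<forall>s. \<rho> s > 0) \<and> diff_op cs (\<lambda>s. exp (s\<^sup>2)) \<rho>"
proof -
  define q where "q = prod_list (map (\<lambda>c. [:- c, 1:]) cs)"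
  have "diff_op cs (\<lambda>s. a * gauss_poly_integral p s)
      (\<lambda>s. a * gauss_poly_integral (p * prod_list (map (\<lambda>c. [:- c, 1:]) cs)) s)" for p a
  proof (induction cs arbitrary: p)
    case (Cons c cs)
    let ?p = "p * [:- c, 1:]"
    \<comment> \<open>The linear polynomial \<open>[:- c, 1:]\<close> at \<open>2 * t\<close> is
      \<open>2 * t - c\<close>, the factor that \<open>D - c\<close> brings down from
      \<open>exp (2 * s * t)\<close>.\<close>
    have "gauss_poly_integral (pCons 0 p) s = c * gauss_poly_integral p s + gauss_poly_integral ?p s" for s
      unfolding gauss_poly_integral_def
      using integrable_gauss_poly[of p s] integrable_gauss_poly[of ?p s]
      by (subst Bochner_Integration.integral_mult_right[symmetric], simp,
          subst Bochner_Integration.integral_add[symmetric])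
        (auto simp: algebra_simps intro!: Bochner_Integration.integral_cong)
    then have "((\<lambda>s. a * gauss_poly_integral p s) has_real_derivative
        c * (a * gauss_poly_integral p s) + a * gauss_poly_integral ?p s) (at s)" for s
      using DERIV_cmult[OF gauss_poly_integral_deriv[of p s], of a] by (simp add: algebra_simps)
    then show ?case using Cons.IH[of ?p] unfolding diff_op.simps list.map prod_list.Cons mult.assoc
      by (intro exI[of _ "\<lambda>s. a * gauss_poly_integral ?p s"] conjI allI)
  qed simp
  from this[of "sqrt 2" 1]
  have "diff_op cs (\<lambda>s. exp (s\<^sup>2)) (\<lambda>s. sqrt 2 * gauss_poly_integral q s)"
    by (simp add: gauss_poly_integral_1 q_def)
  moreover have "poly q t = prod_list (map (\<lambda>c. t - c) cs)" for t
    unfolding q_def by (induction cs) (auto simp: algebra_simps)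
  then have "poly q t \<ge> 0" for t using assms by simp
  moreover have "q \<noteq> 0" by (auto simp: q_def prod_list_zero_iff)
  ultimately show ?thesis using gauss_poly_integral_pos[of q]
    by (intro exI[of _ "\<lambda>s. sqrt 2 * gauss_poly_integral q s"]) auto
qed

section \<open>Certificates for nodes with multiplicity\<close>

context gauss_frame
begin

definition atom_poly :: "nat \<Rightarrow> real \<Rightarrow> real poly" where
  "atom_poly m y = (\<Sum>j\<le>m. monom (acoef m j y) j)"

lemma atom_jet_poly: "atom_jet m y s * exp (s\<^sup>2) = poly (atom_poly m y) s * exp (2 * y * s)"
  by (simp add: atom_jet_def atom_poly_def poly_sum poly_monom mult.assoc flip: exp_add)

lemma coeff_atom_poly: "coeff (atom_poly m y) k = (if k \<le> m then acoef m k y else 0)"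
  by (simp add: atom_poly_def coeff_sum cong: if_cong)

lemma degree_atom_poly: "degree (atom_poly m y) \<le> m"
  by (rule degree_le) (simp add: coeff_atom_poly)

text \<open>With \<open>c\<close> the multiplicity of \<open>y\<close>, only the coefficient of
  degree \<open>c\<close> survives. It is zero for \<open>m < c\<close> and the leading one for
  \<open>m = c\<close>, which covers both clauses of \<open>chebyshev\<close>.\<close>

lemma diff_op_atom_jet:
  fixes \<xi> :: "nat \<Rightarrow> real"
  assumes m: "m \<le> card {i. i < k \<and> \<xi> i = y}"
  defines "c \<equiv> card {i. i < k \<and> \<xi> i = y}"
  shows "diff_op (map (\<lambda>i. 2 * \<xi> i) [0..<k]) (\<lambda>s. atom_jet m y s * exp (s\<^sup>2))
     (\<lambda>s. coeff (atom_poly m y) c * fact c * (\<Prod>i | i < k \<and> \<xi> i \<noteq> y. 2 * y - 2 * \<xi> i) * exp (2 * y * s))"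
proof -
  let ?cs = "map (\<lambda>i. 2 * \<xi> i) [0..<k]"
  have c: "count_list ?cs (2 * y) = c" by (simp add: count_list_map_upt c_def)
  have "degree (atom_poly m y) \<le> count_list ?cs (2 * y)"
    using degree_atom_poly[of m y] m by (simp add: c[unfolded c_def])
  from fold_qpoly_step[OF this]
  have "fold (qpoly_step (2 * y)) ?cs (atom_poly m y) =
      [:coeff (atom_poly m y) c * fact c * (\<Prod>i | i < k \<and> \<xi> i \<noteq> y. 2 * y - 2 * \<xi> i):]"
    by (simp only: c prod_list_filter_map_upt) simp
  with diff_op_qpoly[of ?cs "atom_poly m y" "2 * y"] show ?thesis
    by (simp add: atom_jet_poly)
qed

end

text \<open>Nodes are listed with repetition, in increasing order and each with even multiplicity; the
  \<open>j\<close>-th representer is the derivative of the atom at \<open>\<xi> j\<close> whose order is the number of earlier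
  occurrences of that node.\<close>

locale gauss_nodes = gauss_frame P S for P :: "real measure" and S +
  fixes n :: nat and \<xi> :: "nat \<Rightarrow> real"
  assumes mono: "\<And>i j. i \<le> j \<Longrightarrow> j < n \<Longrightarrow> \<xi> i \<le> \<xi> j"
    and even_mult: "\<And>t. even (card {i. i < n \<and> \<xi> i = t})"
    and support: "finite (measure_support P) \<longrightarrow> card (measure_support P) \<ge> n + 1"
begin

definition ord :: "nat \<Rightarrow> nat" where
  "ord j = card {i. i < j \<and> \<xi> i = \<xi> j}"

definition repr :: "nat \<Rightarrow> real \<Rightarrow> real" where
  "repr j = atom_jet (ord j) (\<xi> j)"

lemma repr_L2: "repr j \<in> L2 P"
  by (simp add: repr_def atom_jet_L2)

text \<open>The set where a continuous function is nonzero is open; if it is null, it misses the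
  support, so all support points are zeros.\<close>

lemma card_zeros_AE:
  assumes cont: "\<And>s. isCont h s" and ae: "AE s in P. h s = 0" and fin: "finite {s. h s = 0}"
  shows "card {s. h s = (0::real)} > n"
proof -
  have "measure_support P \<subseteq> {s. h s = 0}"
  proof
    fix s assume s: "s \<in> measure_support P"
    show "s \<in> {s. h s = 0}"
    proof (rule ccontr)
      assume "s \<notin> {s. h s = 0}"
      moreover have op: "open {s. h s \<noteq> 0}"
      proof -
        have "continuous_on UNIV h" using cont by (simp add: continuous_at_imp_continuous_on)
        then show ?thesis using open_Collect_neq[of h "\<lambda>_. 0"] by simp
      qed
      ultimately have pos: "emeasure P ({s. h s \<noteq> 0} \<inter> space P) > 0"
        using s unfolding measure_support_def by auto
      have m: "{s. h s \<noteq> 0} \<inter> space P \<in> sets P"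
      proof -
        have "h \<in> borel_measurable P"
          using cont by (intro borel_measurable_P borel_measurable_continuous_onI continuous_at_imp_continuous_on) auto
        then have "h -` (- {0}) \<inter> space P \<in> sets P" by (rule measurable_sets) auto
        moreover have "h -` (- {0}) = {s. h s \<noteq> 0}" by auto
        ultimately show ?thesis by simp
      qed
      have "AE s in P. s \<notin> {s. h s \<noteq> 0} \<inter> space P" using ae by eventually_elim simp
      then have "emeasure P ({s. h s \<noteq> 0} \<inter> space P) = 0"
        using AE_iff_null_sets[OF m] by (simp add: null_sets_def)
      with pos show False by simp
    qed
  qed
  then have "finite (measure_support P)" "card (measure_support P) \<le> card {s. h s = 0}"
    using fin by (auto intro: finite_subset card_mono)
  with support show ?thesis by simp
qed

text \<open>The last function is the jet at \<open>y\<close> whose order is the multiplicity of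
  \<open>y\<close> among the nodes. Positivity comes from the increasing order of the nodes for
  \<open>j < n\<close>, and from their even multiplicities for \<open>j = n\<close>, where
  \<open>y\<close> may lie anywhere.\<close>

lemma chebyshev_repr:
  fixes y :: real
  defines "w \<equiv> \<lambda>j s. (if j = n then atom_jet (card {i. i < n \<and> \<xi> i = y}) y s else repr j s) * exp (s\<^sup>2)"
  shows "chebyshev (map (\<lambda>i. 2 * \<xi> i) [0..<n]) n w"
  unfolding chebyshev_def
proof (intro conjI allI impI)
  let ?cs = "map (\<lambda>i. 2 * \<xi> i) [0..<n]"
  have take: "take k ?cs = map (\<lambda>i. 2 * \<xi> i) [0..<k]" if "k \<le> n" for k
    using that by (simp add: take_map take_upt)
  fix j assume j: "j \<le> n"
  define Y where "Y = (if j = n then y else \<xi> j)"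
  define m where "m = card {i. i < j \<and> \<xi> i = Y}"
  have w: "w j = (\<lambda>s. atom_jet m Y s * exp (s\<^sup>2))"
    by (auto simp: w_def m_def Y_def repr_def ord_def)
  have "(\<Prod>i | i < j \<and> \<xi> i \<noteq> Y. 2 * Y - 2 * \<xi> i) = (\<Prod>i | i < j \<and> \<xi> i \<noteq> Y. 2 * (Y - \<xi> i))"
    by (intro prod.cong) auto
  also have "\<dots> > 0"
  proof (cases "j = n")
    case True
    then show ?thesis using prod_even_fibers_pos[where \<xi> = \<xi> and n = n and y = y, OF even_mult]
      by (simp only: Y_def True if_True prod.distrib prod_constant) (simp add: zero_less_mult_iff)
  next
    case False
    show ?thesis
    proof (intro prod_pos)
      fix i assume "i \<in> {i. i < j \<and> \<xi> i \<noteq> Y}"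
      then show "0 < 2 * (Y - \<xi> i)" using mono[of i j] False j by (auto simp: Y_def)
    qed
  qed
  finally have "coeff (atom_poly m Y) m * fact m * (\<Prod>i | i < j \<and> \<xi> i \<noteq> Y. 2 * Y - 2 * \<xi> i) > 0"
    using E_0_pos[of Y] by (simp add: coeff_atom_poly acoef_lead)
  with diff_op_atom_jet[of m j \<xi> Y] show "\<exists>\<omega>. (\<forall>s. \<omega> s > 0) \<and> diff_op (take j ?cs) (w j) \<omega>"
    unfolding take[OF j] w m_def[symmetric]
    by (intro exI conjI, rule_tac[2] diff_op_atom_jet) (auto simp: m_def)
next
  let ?cs = "map (\<lambda>i. 2 * \<xi> i) [0..<n]"
  fix i j assume ij: "i \<le> n" "j < i"
  have take: "take i ?cs = map (\<lambda>i. 2 * \<xi> i) [0..<i]"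
    using ij by (simp add: take_map take_upt)
  have w: "w j = (\<lambda>s. atom_jet (ord j) (\<xi> j) s * exp (s\<^sup>2))"
    using ij by (auto simp: w_def repr_def)
  have "ord j < card {l. l < i \<and> \<xi> l = \<xi> j}"
    unfolding ord_def using ij by (intro psubset_card_mono) auto
  then show "diff_op (take i ?cs) (w j) (\<lambda>_. 0)"
    using diff_op_atom_jet[of "ord j" i \<xi> "\<xi> j"] unfolding take w by (simp add: coeff_atom_poly)
qed

lemma atom_jet_isCont: "isCont (atom_jet m y) s"
  unfolding atom_jet_def[abs_def] by (intro continuous_intros)

text \<open>A nontrivial combination has at most \<open>n - 1\<close> zeros, whereas vanishing
  almost everywhere would give more than \<open>n\<close>.\<close>

lemma repr_independent:
  assumes ae: "AE s in P. (\<Sum>j<n. b j * repr j s) = 0" and j: "j < n"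
  shows "b j = 0"
proof (rule ccontr)
  assume bj: "b j \<noteq> 0"
  define T where "T s = (\<Sum>j\<le>n - 1. b j * (repr j s * exp (s\<^sup>2)))" for s
  define w where "w = (\<lambda>j s. (if j = n then atom_jet (card {i. i < n \<and> \<xi> i = 0}) 0 s else repr j s) * exp (s\<^sup>2))"
  have T_w: "T = (\<lambda>s. \<Sum>j\<le>n - 1. b j * w j s)"
    unfolding T_def w_def using j by (intro ext sum.cong) auto
  have ex: "\<exists>j\<le>n - 1. b j \<noteq> 0" using bj j by (intro exI[of _ j]) simp
  have fin: "finite {s. T s = 0}" and card: "card {s. T s = 0} \<le> n - 1"
    using chebyshev_zeros(1,2)[OF chebyshev_repr[of 0, folded w_def] _ ex] unfolding T_w by auto
  have T: "T s = (\<Sum>j<n. b j * repr j s) * exp (s\<^sup>2)" for s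
  proof -
    have "{..n - 1} = {..<n}" using j by auto
    then show ?thesis by (simp add: T_def sum_distrib_right mult.assoc)
  qed
  have "card {s. T s = 0} > n"
  proof (rule card_zeros_AE[OF _ _ fin])
    show "isCont T s" for s
      unfolding T_def repr_def by (intro continuous_intros atom_jet_isCont)
    show "AE s in P. T s = 0" using ae by eventually_elim (simp add: T)
  qed
  with card show False by simp
qed

text \<open>Off the nodes \<open>m = 0\<close>, and this bounds the certificate by 1. At a node,
  \<open>m\<close> is the first derivative order left free by the constraints, and that derivative
  is negative. Both express the positive inner product of \<open>1 - p\<close> with the jet of order
  \<open>m\<close> at \<open>y\<close>.\<close>

lemma min_norm_certificate_less:
  fixes y :: real
  defines "C \<equiv> {p \<in> L2 P. \<forall>j<n. L2_inner P (repr j) p = L2_inner P (repr j) (\<lambda>_. 1)}"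
  defines "p \<equiv> arg_min_on (L2_norm P) C" and "m \<equiv> card {i. i < n \<and> \<xi> i = y}"
  shows "p \<in> C" "L2_inner P (atom_jet m y) p < (if m = 0 then 1 else 0)"
proof -
  show "p \<in> C"
    unfolding p_def C_def by (rule L2_arg_min_eq_projection(1)[OF repr_L2 const_L2])
  then have pL: "p \<in> L2 P" by (simp add: C_def)
  obtain \<alpha> where \<alpha>: "AE s in P. p s = (\<Sum>i<n. \<alpha> i * repr i s)"
    and perp: "\<And>j. j < n \<Longrightarrow> L2_inner P (repr j) (\<lambda>s. 1 - (\<Sum>i<n. \<alpha> i * repr i s)) = 0"
    using L2_arg_min_eq_projection(2)[where n = n and e = repr and P = P and f = "\<lambda>_. 1", OF repr_L2 const_L2]
    unfolding p_def C_def by blast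
  define cs where "cs = map (\<lambda>i. 2 * \<xi> i) [0..<n]"
  define e where "e j = (if j = n then atom_jet m y else repr j)" for j
  define w where "w j s = e j s * exp (s\<^sup>2)" for j s
  define d where "d s = 1 - (\<Sum>i<n. \<alpha> i * repr i s)" for s
  define r where "r s = d s * exp (s\<^sup>2)" for s
  have eL: "e j \<in> L2 P" for j by (simp add: e_def atom_jet_L2 repr_L2)
  have sumL: "(\<lambda>s. \<Sum>i<n. \<alpha> i * repr i s) \<in> L2 P" by (intro L2_sum repr_L2) simp
  have dL: "d \<in> L2 P" unfolding d_def by (intro L2_diff const_L2 sumL)
  have ch: "chebyshev cs n w"
  proof -
    have "w = (\<lambda>j s. (if j = n then atom_jet m y s else repr j s) * exp (s\<^sup>2))"
      by (auto simp: w_def e_def fun_eq_iff)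
    then show ?thesis using chebyshev_repr[of y] by (simp only: cs_def m_def)
  qed
  \<comment> \<open>The product of all \<open>t - c\<close> is nonnegative because every node occurs
    an even number of times, so the operator keeps \<open>exp (s\<^sup>2)\<close> positive.\<close>
  obtain \<rho> where \<rho>: "\<And>s. \<rho> s > 0" "diff_op cs (\<lambda>s. exp (s\<^sup>2)) \<rho>"
  proof -
    have "0 \<le> prod_list (map (\<lambda>c. t - c) cs)" for t
    proof -
      have "prod_list (map (\<lambda>c. t - c) cs) = (\<Prod>i<n. 2 * (t / 2 - \<xi> i))"
        using prod_list_filter_map_upt[of "\<lambda>c. t - c" "\<lambda>_. True" "\<lambda>i. 2 * \<xi> i" n]
        by (simp add: cs_def algebra_simps lessThan_def)
      also have "\<dots> = 2 ^ n * (\<Prod>i<n. t / 2 - \<xi> i)" by (simp only: prod.distrib) simp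
      also have "\<dots> \<ge> 0" using prod_even_fibers_nonneg[OF even_mult, of "t / 2"] by simp
      finally show ?thesis .
    qed
    then show ?thesis using diff_op_exp_square that by blast
  qed
  have r_op: "diff_op cs r \<rho>"
  proof -
    have "diff_op cs (w i) (\<lambda>_. 0)" if "i \<in> {..<n}" for i
      using ch that unfolding chebyshev_def cs_def by force
    then have "diff_op cs (\<lambda>s. \<Sum>i<n. \<alpha> i * w i s) (\<lambda>s. \<Sum>i<n. \<alpha> i * 0)"
      by (intro diff_op_sum) auto
    from diff_op_lincomb[OF \<rho>(2) this, of 1 "-1"]
    have "diff_op cs (\<lambda>s. 1 * exp (s\<^sup>2) + - 1 * (\<Sum>i<n. \<alpha> i * w i s)) \<rho>" by simp
    moreover have "(\<lambda>s. 1 * exp (s\<^sup>2) + - 1 * (\<Sum>i<n. \<alpha> i * w i s)) = r"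
      by (auto simp: r_def d_def w_def e_def left_diff_distrib sum_distrib_right mult.assoc intro!: sum.cong)
    ultimately show ?thesis by simp
  qed
  \<comment> \<open>The weight \<open>exp (- 2 * s\<^sup>2)\<close> removes the two factors
    \<open>exp (s\<^sup>2)\<close> that made \<open>e j\<close> and \<open>d\<close> accessible to
    the operator.\<close>
  have eq: "w j s * r s * exp (- 2 * s\<^sup>2) = e j s * d s" for j s
    by (simp add: w_def r_def exp_minus exp_double field_simps power2_eq_square flip: exp_add)
  have conte: "isCont (e j) s" for j s
    by (simp add: e_def repr_def atom_jet_isCont)
  have "(\<integral>s. w n s * r s * exp (- 2 * s\<^sup>2) \<partial>P) > 0"
  proof (rule orthogonal_remainder_pos[OF ch _ _ r_op \<rho>(1)])
    show "isCont (w j) s" for j s unfolding w_def by (intro continuous_intros conte)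
    show "isCont r s" for s
      unfolding r_def d_def repr_def by (intro continuous_intros atom_jet_isCont)
    show "integrable P (\<lambda>s. w j s * r s * exp (- 2 * s\<^sup>2))" for j
      unfolding eq by (rule L2_mult_integrable[OF eL dL])
    show "(\<integral>s. w j s * r s * exp (- 2 * s\<^sup>2) \<partial>P) = 0" if "j < n" for j
      unfolding eq using perp[OF that] that by (simp add: L2_inner_def e_def d_def)
  qed (use card_zeros_AE in \<open>auto simp: cs_def\<close>)
  then have "L2_inner P (e n) d > 0" unfolding eq by (simp add: L2_inner_def)
  moreover have "L2_inner P (e n) d = L2_inner P (e n) (\<lambda>_. 1) - L2_inner P (e n) (\<lambda>s. \<Sum>i<n. \<alpha> i * repr i s)"
    unfolding d_def[abs_def] by (rule L2_inner_diff_right[OF const_L2 sumL eL])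
  moreover have "L2_inner P (e n) p = L2_inner P (e n) (\<lambda>s. \<Sum>i<n. \<alpha> i * repr i s)"
    by (rule L2_inner_cong_AE[OF _ \<alpha> eL eL pL sumL]) simp
  ultimately show "L2_inner P (atom_jet m y) p < (if m = 0 then 1 else 0)"
    using L2_inner_atom_jet_1[of m y] by (simp add: e_def)
qed

end

section \<open>The two configurations of nodes\<close>

lemma at_within_interval_nontrivial:
  fixes X :: "real set"
  assumes "is_interval X" "interior X \<noteq> {}" "x \<in> X"
  shows "at x within X \<noteq> bot"
proof -
  have "X \<noteq> {x}" using assms(2) by auto
  then have "x islimpt X"
    using assms by (intro connected_imp_perfect) (auto simp: is_interval_connected)
  then show ?thesis by (simp add: trivial_limit_within)
qed

lemma sum_pairs_reindex:
  fixes M :: nat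
  shows
  "(\<Sum>j<2 * M. f j) = (\<Sum>i=1..M. f (2 * i - 2) + f (2 * i - 1) :: real)"
  by (induction M) (auto simp: algebra_simps)

lemma all_pairs_reindex:
  fixes M :: nat
  shows
  "(\<forall>j<2 * M. Q j) \<longleftrightarrow> (\<forall>i\<in>{1..M}. Q (2 * i - 2) \<and> Q (2 * i - 1))"
proof (intro iffI ballI allI impI)
  fix j assume *: "\<forall>i\<in>{1..M}. Q (2 * i - 2) \<and> Q (2 * i - 1)" and j: "j < 2 * M"
  define i where "i = j div 2 + 1"
  have "i \<in> {1..M}" "j = 2 * i - 2 \<or> j = 2 * i - 1" using j by (auto simp: i_def)
  with * show "Q j" by blast
qed auto

text \<open>The list \<open>x 1, x 1, x 2, x 2, \<dots>\<close>, indexed from 0 while the nodes are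
  numbered from 1.\<close>

definition doubled :: "(nat \<Rightarrow> real) \<Rightarrow> nat \<Rightarrow> real" where
  "doubled x j = x (j div 2 + 1)"

text \<open>Arbitrary initial segments are allowed, since \<open>ord\<close> counts earlier
  occurrences while the multiplicity counts all of them.\<close>

lemma doubled_fiber:
  assumes x: "strict_mono_on {1..M} x" and k: "k \<in> {1..M}" and n: "n \<le> 2 * M"
  shows "{i. i < n \<and> doubled x i = x k} = {i. i < n \<and> (i = 2 * k - 2 \<or> i = 2 * k - 1)}"
proof -
  have "x (i div 2 + 1) = x k \<longleftrightarrow> i div 2 + 1 = k" if "i < n" for i
    using inj_on_eq_iff[OF strict_mono_on_imp_inj_on[OF x], of "i div 2 + 1" k] that k n by auto
  moreover have "i div 2 + 1 = k \<longleftrightarrow> i = 2 * k - 2 \<or> i = 2 * k - 1" for i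
    using k by auto
  ultimately show ?thesis unfolding doubled_def by blast
qed

lemma card_doubled:
  assumes x: "strict_mono_on {1..M} x"
  shows "card {i. i < 2 * M \<and> doubled x i = t} = (if t \<in> x ` {1..M} then 2 else 0)"
proof (cases "t \<in> x ` {1..M}")
  case True
  then obtain k where k: "k \<in> {1..M}" "t = x k" by auto
  have "{i. i < 2 * M \<and> doubled x i = t} = {2 * k - 2, 2 * k - 1}"
    unfolding k(2) doubled_fiber[OF x k(1) order_refl] using k(1) by auto
  moreover have "2 * k - 2 \<noteq> 2 * k - 1" using k(1) by auto
  ultimately show ?thesis using True by simp
next
  case False
  have "doubled x i \<in> x ` {1..M}" if "i < 2 * M" for i
    unfolding doubled_def using that by (intro imageI) auto
  with False have "{i. i < 2 * M \<and> doubled x i = t} = {}" by auto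
  with False show ?thesis by simp
qed

section \<open>Non-degeneracy for separated nodes and for one multiple node\<close>

context gauss_frame
begin

lemma gauss_nodes_doubled:
  assumes x: "strict_mono_on {1..M} x"
    and supp: "finite (measure_support P) \<longrightarrow> card (measure_support P) \<ge> 2 * M + 1"
  shows "gauss_nodes P S (2 * M) (doubled x)"
proof unfold_locales
  show "doubled x i \<le> doubled x j" if "i \<le> j" "j < 2 * M" for i j
    unfolding doubled_def using that
    by (intro strict_mono_on_leD[OF x]) (auto intro!: div_le_mono)
  show "even (card {i. i < 2 * M \<and> doubled x i = t})" for t
    by (simp add: card_doubled[OF x])
qed (rule supp)

lemma gauss_nodes_const:
  assumes supp: "finite (measure_support P) \<longrightarrow> card (measure_support P) \<ge> 2 * M + 1"
  shows "gauss_nodes P S (2 * M) (\<lambda>_. x0)"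
proof unfold_locales
  show "even (card {i. i < 2 * M \<and> x0 = t})" for t by (cases "x0 = t") auto
qed (use supp in auto)

lemma repr_doubled:
  assumes x: "strict_mono_on {1..M} x"
    and supp: "finite (measure_support P) \<longrightarrow> card (measure_support P) \<ge> 2 * M + 1"
    and i: "i \<in> {1..M}"
  shows "gauss_nodes.repr P (doubled x) (2 * i - 2) = atom_jet 0 (x i)"
    and "gauss_nodes.repr P (doubled x) (2 * i - 1) = atom_jet 1 (x i)"
proof -
  interpret gauss_nodes P S "2 * M" "doubled x" by (rule gauss_nodes_doubled[OF x supp])
  have d: "doubled x (2 * i - 2) = x i" "doubled x (2 * i - 1) = x i"
    using i by (auto simp: doubled_def Suc_double_not_eq_double
        intro!: arg_cong[of _ _ x] dest!: Suc_le_D)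
  have fib: "{l. l < 2 * i - 2 \<and> doubled x l = x i} = {}"
    using i by (subst doubled_fiber[OF x i]) auto
  then show "repr (2 * i - 2) = atom_jet 0 (x i)" by (simp only: repr_def ord_def d fib card.empty)
  have fib': "{l. l < 2 * i - 1 \<and> doubled x l = x i} = {2 * i - 2}"
    using i by (subst doubled_fiber[OF x i]) auto
  then show "repr (2 * i - 1) = atom_jet 1 (x i)" by (simp only: repr_def ord_def d fib') simp
qed

text \<open>For doubled nodes the representers are the atoms and their first derivatives, so the
  minimal-norm problem is that of \<open>p_V\<close>. The multiplicity is 2 at a node and 0
  elsewhere, giving the second-derivative condition and the bound by 1.\<close>

lemma NDSC_gauss_atom:
  assumes X: "\<And>x. x \<in> X \<Longrightarrow> at x within X \<noteq> bot"
    and supp: "finite (measure_support P) \<longrightarrow> card (measure_support P) \<ge> 2 * M + 1"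
    and x: "strict_mono_on {1..M} x" and xa: "\<forall>i\<in>{1..M}. x i \<in> interior X \<and> a i > 0"
  shows "NDSC P X (gauss_atom P) (dirac_sum X M a x)"
proof -
  interpret gauss_nodes P S "2 * M" "doubled x" by (rule gauss_nodes_doubled[OF x supp])
  note repr_x = repr_doubled[OF x supp]
  have xX: "x i \<in> X" if "i \<in> {1..M}" for i using xa that interior_subset by blast
  define C where "C = {p \<in> L2 P. \<forall>j<2 * M. L2_inner P (repr j) p = L2_inner P (repr j) (\<lambda>_. 1)}"
  have C: "{p \<in> L2 P. \<forall>i\<in>{1..M}. Phi_adj P (gauss_atom P) p (x i) = 1 \<and>
      deriv (Phi_adj P (gauss_atom P) p) (x i) = 0} = C"
  proof -
    have "Phi_adj P (gauss_atom P) p y = L2_inner P (atom_jet 0 y) p"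
      "deriv (Phi_adj P (gauss_atom P) p) y = L2_inner P (atom_jet 1 y) p" if "p \<in> L2 P" for p y
      using nth_deriv_Phi_adj[OF that, of 0] nth_deriv_Phi_adj[OF that, of 1] by simp_all
    then show ?thesis
      unfolding C_def all_pairs_reindex by (auto simp: repr_x L2_inner_atom_jet_1 simp del: One_nat_def)
  qed
  define p where "p = arg_min_on (L2_norm P) C"
  have p: "p_V P (gauss_atom P) M x = p" by (simp only: p_V_def C p_def)
  have pL: "p \<in> L2 P" using min_norm_certificate_less(1) by (simp add: p_def C_def)
  have eta: "(deriv ^^ k) (eta_V P (gauss_atom P) M x) = (\<lambda>y. L2_inner P (atom_jet k y) p)" for k
    unfolding eta_V_def p by (rule nth_deriv_Phi_adj[OF pL])
  have less: "L2_inner P (atom_jet (if y \<in> x ` {1..M} then 2 else 0) y) p < (if y \<in> x ` {1..M} then 0 else 1)" for y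
    using min_norm_certificate_less(2)[of y] unfolding card_doubled[OF x] p_def C_def by (auto split: if_splits)
  have rank: "full_rank P (2 * M) (Gamma_op P X (gauss_atom P) M x)"
    unfolding full_rank_def
  proof (intro allI impI ballI)
    fix b c j
    assume ae: "AE s in P. Gamma_op P X (gauss_atom P) M x b s = Gamma_op P X (gauss_atom P) M x c s"
      and j: "j \<in> {1..2 * M}"
    have "AE s in P. \<forall>i\<in>{1..M}. L2_deriv P X (gauss_atom P) (x i) s = atom_jet 1 (x i) s"
    proof (rule AE_finite_allI)
      fix i assume "i \<in> {1..M}"
      with L2_nth_deriv_gauss_atom(2)[of X "x i" 1, OF X xX]
      show "AE s in P. L2_deriv P X (gauss_atom P) (x i) s = atom_jet 1 (x i) s" by simp
    qed simp
    \<comment> \<open>Vectors are numbered from 1 and representers from 0, hence the shift by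
      one.\<close>
    with ae have "AE s in P. (\<Sum>j<2 * M. (b (j + 1) - c (j + 1)) * repr j s) = 0"
    proof eventually_elim
      case (elim s)
      have "(\<Sum>j<2 * M. d (j + 1) * repr j s) = Gamma_op P X (gauss_atom P) M x d s" for d
        unfolding sum_pairs_reindex Gamma_op_def
      proof (intro sum.cong refl)
        fix i assume i: "i \<in> {1..M}"
        then have "2 * i - 2 + 1 = 2 * i - 1" "2 * i - 1 + 1 = 2 * i" by auto
        then show "d (2 * i - 2 + 1) * repr (2 * i - 2) s + d (2 * i - 1 + 1) * repr (2 * i - 1) s =
          d (2 * i - 1) * gauss_atom P (x i) s + d (2 * i) * L2_deriv P X (gauss_atom P) (x i) s"
          using elim(2) i by (simp only: repr_x[OF i] atom_jet_0)
      qed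
      with elim(1) show ?case by (simp add: left_diff_distrib sum_subtractf)
    qed
    from repr_independent[OF this, of "j - 1"] j show "b j = c j" by auto
  qed
  have "eta_V P (gauss_atom P) M x y < 1" if "y \<notin> x ` {1..M}" for y
    using less[of y] that fun_cong[OF eta[of 0], of y] by simp
  moreover have "(deriv ^^ 2) (eta_V P (gauss_atom P) M x) (x i) < 0" if "i \<in> {1..M}" for i
    using less[of "x i"] that by (simp only: eta) simp
  ultimately show ?thesis unfolding NDSC_def using rank x xa by blast
qed

text \<open>One node repeated \<open>2 * M\<close> times has the jets of order
  \<open>0, \<dots>, 2 * M - 1\<close> as representers, so the problem is that of \<open>p_W\<close>
  and the first free derivative at \<open>x0\<close> has order \<open>2 * M\<close>.\<close>

lemma eta_W_nondegenerate_gauss_atom: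
  assumes X: "\<And>x. x \<in> X \<Longrightarrow> at x within X \<noteq> bot"
    and supp: "finite (measure_support P) \<longrightarrow> card (measure_support P) \<ge> 2 * M + 1"
    and M: "M \<ge> 1" and x0: "x0 \<in> X"
  shows "eta_W_nondegenerate P X (gauss_atom P) (2 * M - 1) x0"
proof -
  interpret gauss_nodes P S "2 * M" "\<lambda>_. x0" by (rule gauss_nodes_const[OF supp])
  have repr: "repr j = atom_jet j x0" for j by (simp add: repr_def ord_def)
  have n: "2 * M - 1 + 1 = 2 * M" using M by simp
  define C where "C = {p \<in> L2 P. \<forall>j<2 * M. L2_inner P (repr j) p = L2_inner P (repr j) (\<lambda>_. 1)}"
  have C: "{p \<in> L2 P. Phi_adj P (gauss_atom P) p x0 = 1 \<and>
      (\<forall>k\<in>{1..2 * M - 1}. (deriv ^^ k) (Phi_adj P (gauss_atom P) p) x0 = 0)} = C"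
  proof -
    have "(\<forall>j<2 * M. Q j) \<longleftrightarrow> Q 0 \<and> (\<forall>k\<in>{1..2 * M - 1}. Q k)" for Q
    proof (intro iffI conjI allI ballI impI)
      fix j assume "Q 0 \<and> (\<forall>k\<in>{1..2 * M - 1}. Q k)" "j < 2 * M"
      then show "Q j" by (cases j) auto
    qed (use M in auto)
    moreover have "Phi_adj P (gauss_atom P) p y = L2_inner P (atom_jet 0 y) p" if "p \<in> L2 P" for p y
      using nth_deriv_Phi_adj[OF that, of 0] by simp
    ultimately show ?thesis
      unfolding C_def by (auto simp: repr L2_inner_atom_jet_1 nth_deriv_Phi_adj)
  qed
  define p where "p = arg_min_on (L2_norm P) C"
  have p: "p_W P (gauss_atom P) (2 * M - 1) x0 = p" by (simp only: p_W_def C p_def)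
  have pL: "p \<in> L2 P" using min_norm_certificate_less(1) by (simp add: p_def C_def)
  have eta: "(deriv ^^ k) (eta_W P (gauss_atom P) (2 * M - 1) x0) = (\<lambda>y. L2_inner P (atom_jet k y) p)" for k
    unfolding eta_W_def p by (rule nth_deriv_Phi_adj[OF pL])
  have card: "card {i. i < 2 * M \<and> x0 = y} = (if y = x0 then 2 * M else 0)" for y by auto
  have less: "L2_inner P (atom_jet (if y = x0 then 2 * M else 0) y) p < (if y = x0 then 0 else 1)" for y
    using min_norm_certificate_less(2)[of y] M unfolding card p_def C_def by (auto split: if_splits)
  have rank: "full_rank P (2 * M - 1 + 1) (F_op P X (gauss_atom P) (2 * M - 1) x0)"
    unfolding full_rank_def n
  proof (intro allI impI ballI)
    fix b c j
    assume ae: "AE s in P. F_op P X (gauss_atom P) (2 * M - 1) x0 b s = F_op P X (gauss_atom P) (2 * M - 1) x0 c s"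
      and j: "j \<in> {1..2 * M}"
    have "AE s in P. \<forall>k\<in>{..<2 * M}. L2_nth_deriv P X (gauss_atom P) k x0 s = atom_jet k x0 s"
      by (intro AE_finite_allI L2_nth_deriv_gauss_atom(2) X x0) simp
    with ae have "AE s in P. (\<Sum>j<2 * M. (b (j + 1) - c (j + 1)) * repr j s) = 0"
    proof eventually_elim
      case (elim s)
      have "{0..2 * M - 1} = {..<2 * M}" using M by auto
      then have "F_op P X (gauss_atom P) (2 * M - 1) x0 d s = (\<Sum>j<2 * M. d (j + 1) * repr j s)" for d
        unfolding F_op_def using elim(2) by (auto simp: repr intro!: sum.cong)
      with elim(1) show ?case by (simp add: left_diff_distrib sum_subtractf)
    qed
    from repr_independent[OF this, of "j - 1"] j show "b j = c j" by auto
  qed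
  have "eta_W P (gauss_atom P) (2 * M - 1) x0 y < 1" if "y \<noteq> x0" for y
    using less[of y] that fun_cong[OF eta[of 0], of y] by simp
  moreover have "(deriv ^^ (2 * M - 1 + 1)) (eta_W P (gauss_atom P) (2 * M - 1) x0) x0 < 0"
    unfolding n using less[of x0] by (simp only: eta) simp
  ultimately show ?thesis unfolding eta_W_nondegenerate_def using rank by blast
qed

end

text \<open>Membership in the class of order \<open>2 * M\<close> is claimed for compact
  \<open>X\<close>, as \<open>class_K_gauss_atom_imp_compact\<close> shows it to fail otherwise. For
  general \<open>X\<close> the regularity in \<open>L2\<close> and all conditions on the certificate
  are asserted.\<close>

theorem corollary3:
  fixes M :: nat and X S :: "real set" and P :: "real measure"
  assumes "M \<ge> 1"
    and "is_interval X" and "is_interval S"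
    and "finite_measure P" and "sets P = sets (restrict_space borel S)"
    and "finite (measure_support P) \<longrightarrow> card (measure_support P) \<ge> 2 * M + 1"
  shows
    "(\<forall>(m0 :: real measure) (a :: nat \<Rightarrow> real) (x :: nat \<Rightarrow> real).
        m0 = dirac_sum X M a x \<and> strict_mono_on {1..M} x \<and>
        (\<forall>i\<in>{1..M}. x i \<in> interior X \<and> a i > 0) \<longrightarrow>
        NDSC P X (gauss_atom P) m0) \<and>
     (\<forall>x0 :: real. x0 \<in> interior X \<longrightarrow>
        L2_Ck P X (2 * M) (gauss_atom P) \<and>
        eta_W_nondegenerate P X (gauss_atom P) (2 * M - 1) x0 \<and>
        (compact X \<longrightarrow> nondegenerate_point P X (gauss_atom P) (2 * M - 1) x0))"
proof -
  \<comment> \<open>An empty support would be finite of cardinality 0. A support point, with the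
    whole line as its neighbourhood, shows that \<open>P\<close> has positive mass.\<close>
  have "measure_support P \<noteq> {}" using assms(6) by auto
  then obtain s where "s \<in> measure_support P" by blast
  then have "emeasure P (UNIV \<inter> space P) > 0" unfolding measure_support_def by blast
  then interpret gauss_frame P S
    using assms(4,5) by (auto simp: gauss_frame_def gauss_frame_axioms_def)
  have X: "at x within X \<noteq> bot" if "y \<in> interior X" "x \<in> X" for x y
    using at_within_interval_nontrivial[OF assms(2) _ that(2)] that(1) by blast
  show ?thesis
  proof (intro conjI allI impI)
    fix m0 a x
    assume *: "m0 = dirac_sum X M a x \<and> strict_mono_on {1..M} x \<and>
        (\<forall>i\<in>{1..M}. x i \<in> interior X \<and> a i > 0)"
    \<comment> \<open>As \<open>M \<ge> 1\<close> there is a node, so \<open>X\<close> has nonempty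
      interior and hence no isolated points.\<close>
    then have "x 1 \<in> interior X" using assms(1) by auto
    with * show "NDSC P X (gauss_atom P) m0"
      using NDSC_gauss_atom[OF X[OF \<open>x 1 \<in> interior X\<close>] assms(6), of x a] by blast
  next
    fix x0 assume x0: "x0 \<in> interior X"
    note X' = X[OF x0]
    show "L2_Ck P X (2 * M) (gauss_atom P)" by (rule L2_Ck_gauss_atom[OF X'])
    show nd: "eta_W_nondegenerate P X (gauss_atom P) (2 * M - 1) x0"
      using eta_W_nondegenerate_gauss_atom[OF X' assms(6,1), of x0] x0 interior_subset by blast
    assume "compact X"
    then show "nondegenerate_point P X (gauss_atom P) (2 * M - 1) x0"
      unfolding nondegenerate_point_def using nd class_K_gauss_atom[OF X'] by blast
  qed
qed

end
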